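(* Let $\sigma_{\mathrm t},\sigma_{\mathrm a},f$ satisfy the conditions in the context and let $\bm{u}=(u_1,u_2,\dots,u_L)^T$ be the solution of the $P_N$ equations. Then $$\|u_1\|=\mathcal{O}(1),\qquad \|u_i\|=\mathcal{O}(\varepsilon),\quad i=2,3,\dots,L,$$ and furthermore $\|\bm{u}\|=\mathcal{O}(1+\varepsilon)$. That is, there is a constant $C>0$ independent of $\varepsilon\in(0,1)$ (it may depend on $N,f,\sigma_{\mathrm t},\sigma_{\mathrm a}$) such that $\|u_1\|\le C$, $\|u_i\|\le C\varepsilon$ for $i=2,\dots,L$, and $\|\bm{u}\|\le C(1+\varepsilon)$.
   Context: Let $X=(0,1)^3$, $\mathbb{S}$ the unit sphere in $\mathbb{R}^3$, $0<\varepsilon<1$. Conditions: $\sigma_{\mathrm t},\sigma_{\mathrm a}\in L^\infty(X)$ with $\sigma_{\mathrm t}-\varepsilon^2\sigma_{\mathrm a}>0$ a.e. in $X$; $\sigma_{\mathrm t}>\sigma_{\mathrm a}\ge\sigma_{\mathrm a}^{\min}$ in $X$ for some constant $\sigma_{\mathrm a}^{\min}>0$; $f\in L^2(X\times\mathbb{S})$. The data $\sigma_{\mathrm t},\sigma_{\mathrm a},f$ do not depend on $\varepsilon$. $P_N$ equations: let $N\ge0$ and let $\bm{m}$ be the column vector of the $L=(N+1)^2$ real-valued spherical harmonics $m_\ell^\kappa$, $0\le\ell\le N$, $|\kappa|\le\ell$, orthonormal in $L^2(\mathbb{S})$ and ordered by increasing $\ell$. Put $\bm{A}^{(i)}=\int_{\mathbb{S}}\omega_i\bm{m}\bm{m}^{T}d\bm{\omega}$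 ($i=1,2,3$), $\bm{f}=\int_{\mathbb{S}}\bm{m}f\,d\bm{\omega}$, and $\bm{Q}=\mathrm{diag}(\varepsilon\sigma_{\mathrm a},\frac{\sigma_{\mathrm t}}{\varepsilon},\dots,\frac{\sigma_{\mathrm t}}{\varepsilon})$. The function $\bm{u}:X\to\mathbb{R}^L$ is the unique solution of $$\sum_{i=1}^3\bm{A}^{(i)}\partial_i\bm{u}+\bm{Q}\bm{u}=\varepsilon\bm{f}\ \text{ in }X$$ with periodic boundary conditions, in the space of $\bm{u}\in[L^2(X)]^L$ with $\sum_i\bm{A}^{(i)}\partial_i\bm{u}\in[L^2(X)]^L$ that are $1$-periodic in each argument. $\|\cdot\|$ is the $L^2(X)$ norm for scalar functions, and $\|\bm{u}\|^2=\sum_{i=1}^L\|u_i\|^2$. *)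

theory Defs
  imports "HOL-Analysis.Analysis" "HOL-Computational_Algebra.Polynomial"
begin

section \<open>Domain, sphere and Lebesgue spaces\<close>

definition cube :: "(real^3) set" where
  "cube = {x. \<forall>i. 0 < x $ i \<and> x $ i < 1}"

text \<open>Surface measure on the unit sphere as the cone measure: the area of a Borel set
  \<open>A\<close> of the sphere is three times the volume of \<open>{t \<omega>. 0 < t < 1, \<omega> \<in> A}\<close>
  (polar coordinates, as \<open>\<integral>\<^sub>0\<^sup>1 t\<^sup>2 dt = 1/3\<close>). Its total mass is \<open>4 \<pi>\<close>.\<close>

definition sphere_measure :: "(real^3) measure" where
  "sphere_measure =
     distr (scale_measure 3 (restrict_space lborel (ball 0 1 - {0})))
           (restrict_space borel (sphere 0 1)) sgn"

definition L2 :: "'a measure \<Rightarrow> ('a \<Rightarrow> real) set" where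
  "L2 M = {f \<in> borel_measurable M. integrable M (\<lambda>x. (f x)\<^sup>2)}"

definition L2_norm :: "'a measure \<Rightarrow> ('a \<Rightarrow> real) \<Rightarrow> real" where
  "L2_norm M f = sqrt (\<integral>x. (f x)\<^sup>2 \<partial>M)"

definition Linfty :: "'a measure \<Rightarrow> ('a \<Rightarrow> real) set" where
  "Linfty M = {f \<in> borel_measurable M. \<exists>K. AE x in M. \<bar>f x\<bar> \<le> K}"


section \<open>Real spherical harmonics\<close>

text \<open>Rodrigues' formula.\<close>

definition legendre :: "nat \<Rightarrow> real poly" where
  "legendre l = smult (1 / (2 ^ l * fact l)) ((pderiv ^^ l) ([:-1, 0, 1:] ^ l))"

text \<open>The orthonormal real spherical harmonic of degree \<open>l\<close> and order \<open>k\<close>, \<open>\<bar>k\<bar> \<le> l\<close>,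
  without Condon--Shortley phase. In spherical coordinates
  \<open>\<omega> = (sin \<theta> cos \<phi>, sin \<theta> sin \<phi>, cos \<theta>)\<close> one has
  \<open>(\<omega>\<^sub>1 + i \<omega>\<^sub>2)^n = sin\<^sup>n \<theta> (cos (n \<phi>) + i sin (n \<phi>))\<close>, and \<open>sin\<^sup>n \<theta>\<close> times the
  \<open>n\<close>-th derivative of the Legendre polynomial at \<open>cos \<theta>\<close> is the associated Legendre
  function of order \<open>n\<close> at \<open>cos \<theta>\<close>.\<close>

definition harmonic :: "nat \<Rightarrow> int \<Rightarrow> real^3 \<Rightarrow> real" where
  "harmonic l k \<omega> =
    (let n = nat \<bar>k\<bar>; z = Complex (\<omega> $ 1) (\<omega> $ 2) ^ n in
      sqrt ((2 * real l + 1) / (4 * pi) * (fact (l - n) / fact (l + n)))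
      * poly ((pderiv ^^ n) (legendre l)) (\<omega> $ 3)
      * (if k = 0 then 1 else if k > 0 then sqrt 2 * Re z else sqrt 2 * Im z))"

text \<open>Ordered by increasing degree and, within one degree, by increasing order.\<close>

definition harmonic_indices :: "nat \<Rightarrow> (nat \<times> int) list" where
  "harmonic_indices N = concat (map (\<lambda>l. map (\<lambda>k. (l, k)) [- int l..int l]) [0..<Suc N])"

lemma length_harmonic_indices: "length (harmonic_indices N) = (N + 1)\<^sup>2"
  by (induction N) (auto simp: harmonic_indices_def power2_eq_square)

text \<open>Vectors of length \<open>(N + 1)\<^sup>2\<close> are functions of an index that ranges over \<open>{1..dimPN N}\<close>.\<close>

definition dimPN :: "nat \<Rightarrow> nat" where
  "dimPN N = (N + 1)\<^sup>2"

definition mvec :: "nat \<Rightarrow> nat \<Rightarrow> real^3 \<Rightarrow> real" where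
  "mvec N j = (case harmonic_indices N ! (j - 1) of (l, k) \<Rightarrow> harmonic l k)"


section \<open>The \<open>P\<^sub>N\<close> equations\<close>

definition Amat :: "nat \<Rightarrow> 3 \<Rightarrow> nat \<Rightarrow> nat \<Rightarrow> real" where
  "Amat N i j k = (\<integral>\<omega>. \<omega> $ i * mvec N j \<omega> * mvec N k \<omega> \<partial>sphere_measure)"

definition fvec :: "nat \<Rightarrow> (real^3 \<Rightarrow> real^3 \<Rightarrow> real) \<Rightarrow> nat \<Rightarrow> real^3 \<Rightarrow> real" where
  "fvec N f j x = (\<integral>\<omega>. mvec N j \<omega> * f x \<omega> \<partial>sphere_measure)"

definition Qmat :: "real \<Rightarrow> (real^3 \<Rightarrow> real) \<Rightarrow> (real^3 \<Rightarrow> real) \<Rightarrow> real^3 \<Rightarrow> nat \<Rightarrow> nat \<Rightarrow> real" where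
  "Qmat \<epsilon> \<sigma>t \<sigma>a x j k =
     (if j \<noteq> k then 0 else if j = 1 then \<epsilon> * \<sigma>a x else \<sigma>t x / \<epsilon>)"

definition partial_deriv :: "3 \<Rightarrow> (real^3 \<Rightarrow> real) \<Rightarrow> real^3 \<Rightarrow> real" where
  "partial_deriv i \<phi> x = frechet_derivative \<phi> (at x) (axis i 1)"

text \<open>Smooth functions with compact support: \<open>foldr partial_deriv is \<phi>\<close> ranges over all
  iterated partial derivatives of \<open>\<phi>\<close> as the list \<open>is\<close> varies.\<close>

definition test_functions :: "(real^3 \<Rightarrow> real) set" where
  "test_functions =
     {\<phi>. (\<forall>is x. foldr partial_deriv is \<phi> differentiable (at x)) \<and> compact (closure {x. \<phi> x \<noteq> 0})}"

definition periodic :: "(real^3 \<Rightarrow> real) \<Rightarrow> bool" where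
  "periodic v \<longleftrightarrow> (\<forall>x i. v (x + axis i 1) = v x)"

text \<open>\<open>u x j\<close> is the \<open>j\<close>-th component of \<open>u(x)\<close>. The relation says that
  \<open>\<Sum>\<^sub>i A\<^sup>(\<^sup>i\<^sup>) \<partial>\<^sub>i u = g\<close> in the sense of distributions. Periodic functions
  are defined on the whole space and the test functions are not confined to \<open>cube\<close>; this is
  what makes the traces of \<open>u\<close> on opposite faces of \<open>cube\<close> match.\<close>

definition has_weak_A_derivative ::
    "nat \<Rightarrow> (real^3 \<Rightarrow> nat \<Rightarrow> real) \<Rightarrow> (real^3 \<Rightarrow> nat \<Rightarrow> real) \<Rightarrow> bool" where
  "has_weak_A_derivative N u g \<longleftrightarrow>
     (\<forall>j\<in>{1..dimPN N}. \<forall>\<phi>\<in>test_functions.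
        (\<integral>x. (\<Sum>i\<in>UNIV. (\<Sum>k=1..dimPN N. Amat N i j k * u x k) * partial_deriv i \<phi> x) \<partial>lebesgue)
        = - (\<integral>x. g x j * \<phi> x \<partial>lebesgue))"

definition periodic_L2_vec :: "nat \<Rightarrow> (real^3 \<Rightarrow> nat \<Rightarrow> real) \<Rightarrow> bool" where
  "periodic_L2_vec N u \<longleftrightarrow>
     (\<forall>j\<in>{1..dimPN N}. periodic (\<lambda>x. u x j) \<and> (\<lambda>x. u x j) \<in> L2 (lebesgue_on cube))"

text \<open>\<open>u\<close> is \<open>1\<close>-periodic and square integrable on \<open>cube\<close>, so is
  \<open>g = \<Sum>\<^sub>i A\<^sup>(\<^sup>i\<^sup>) \<partial>\<^sub>i u\<close>, and \<open>g + Q u = \<epsilon> f\<close> holds almost everywhere in \<open>cube\<close>.\<close>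

definition PN_solution ::
    "nat \<Rightarrow> real \<Rightarrow> (real^3 \<Rightarrow> real) \<Rightarrow> (real^3 \<Rightarrow> real) \<Rightarrow> (real^3 \<Rightarrow> real^3 \<Rightarrow> real)
      \<Rightarrow> (real^3 \<Rightarrow> nat \<Rightarrow> real) \<Rightarrow> bool" where
  "PN_solution N \<epsilon> \<sigma>t \<sigma>a f u \<longleftrightarrow>
     periodic_L2_vec N u \<and>
     (\<exists>g. periodic_L2_vec N g \<and> has_weak_A_derivative N u g \<and>
        (AE x in lebesgue_on cube. \<forall>j\<in>{1..dimPN N}.
           g x j + (\<Sum>k=1..dimPN N. Qmat \<epsilon> \<sigma>t \<sigma>a x j k * u x k) = \<epsilon> * fvec N f j x))"

definition vec_norm :: "nat \<Rightarrow> (real^3 \<Rightarrow> nat \<Rightarrow> real) \<Rightarrow> real" where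
  "vec_norm N u = sqrt (\<Sum>j=1..dimPN N. (L2_norm (lebesgue_on cube) (\<lambda>x. u x j))\<^sup>2)"

end

theory Submission
  imports Defs
begin

text \<open>Testing the equation with \<open>u\<close> kills the transport term, because the matrices \<open>A\<^sup>(\<^sup>i\<^sup>)\<close> are symmetric
  and \<open>u\<close> is periodic; the diagonal term then absorbs the source by Young's inequality.
  As only the combination \<open>g = \<Sum>\<^sub>i A\<^sup>(\<^sup>i\<^sup>) \<partial>\<^sub>i u\<close> is in \<open>L\<^sup>2\<close>, the first step needs an argument. Use the translates
  \<open>\<rho>(\<cdot> - a)\<close> of a radial bump as test functions, multiply by \<open>u(a)\<close> and integrate over \<open>a\<close> in the cell. With
  \<open>c\<^sub>v\<^sub>w(z) = \<integral> v(a) w(a + z) da\<close> this reads \<open>\<Sum>\<^sub>j \<integral> \<rho> c\<^bsub>u\<^sub>j g\<^sub>j\<^esub> = - \<Sum>\<^sub>i\<^sub>j\<^sub>k A\<^sup>(\<^sup>i\<^sup>)\<^sub>j\<^sub>k \<integral> \<partial>\<^sub>i\<rho> c\<^bsub>u\<^sub>j u\<^sub>k\<^esub>\<close>, and the right-hand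
  side vanishes as \<open>\<partial>\<^sub>i\<rho>\<close> is odd and \<open>c\<^sub>v\<^sub>w(-z) = c\<^sub>w\<^sub>v(z)\<close>. Since \<open>\<Sum>\<^sub>j c\<^bsub>u\<^sub>j g\<^sub>j\<^esub>\<close> is continuous at \<open>0\<close> and
  its integrals against all \<open>\<rho>\<close> are \<open>0\<close>, its value \<open>\<integral> u \<cdot> g\<close> at \<open>0\<close> is \<open>0\<close>.\<close>

section \<open>Radial bump functions as test functions\<close>

text \<open>The polynomial in 1/t is carried along because differentiating exp(-1/t) produces such
  factors; the family over all \<open>p\<close> is closed under differentiation.\<close>

definition flat_exp :: "real poly \<Rightarrow> real \<Rightarrow> real" where
  "flat_exp p t = (if t > 0 then poly p (1 / t) * exp (- (1 / t)) else 0)"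

lemma poly_times_exp_neg_tendsto_0:
  fixes p :: "real poly"
  shows "((\<lambda>s. poly p s * exp (- s)) \<longlongrightarrow> 0) at_top"
proof -
  have "((\<lambda>s. \<Sum>i\<le>degree p. coeff p i * (s ^ i / exp s)) \<longlongrightarrow> (\<Sum>i\<le>degree p. coeff p i * 0)) at_top"
    by (intro tendsto_sum tendsto_mult tendsto_const tendsto_power_div_exp_0)
  then show ?thesis
    by (simp add: poly_altdef exp_minus divide_inverse sum_distrib_right mult.assoc)
qed

lemma flat_exp_tendsto_0: "(flat_exp p \<longlongrightarrow> 0) (at_right 0)"
proof -
  have "((\<lambda>t. poly p (inverse t) * exp (- inverse t)) \<longlongrightarrow> 0) (at_right (0::real))"
    using filterlim_compose[OF poly_times_exp_neg_tendsto_0 filterlim_inverse_at_top_right] .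
  moreover have "eventually (\<lambda>t. poly p (inverse t) * exp (- inverse t) = flat_exp p t) (at_right 0)"
    by (auto simp: eventually_at_right_field flat_exp_def inverse_eq_divide intro: exI[of _ 1])
  ultimately show ?thesis
    by (rule Lim_transform_eventually)
qed

text \<open>With s = 1/t the chain rule contributes the factor -s^2, and p(s) exp(-s) has
  s-derivative (p' - p)(s) exp(-s); this gives the new polynomial s^2 (p - p'). At t = 0 the
  one-sided difference quotients are treated separately.\<close>

lemma flat_exp_has_derivative:
  "(flat_exp p has_real_derivative flat_exp ([:0, 0, 1:] * (p - pderiv p)) t) (at t)"
proof -
  consider "t > 0" | "t < 0" | "t = 0" by linarith
  then show ?thesis
  proof cases
    case 1
    have "((\<lambda>t. poly p (1 / t) * exp (- (1 / t))) has_real_derivative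
        flat_exp ([:0, 0, 1:] * (p - pderiv p)) t) (at t)"
      using 1 by (auto intro!: derivative_eq_intros poly_DERIV[THEN DERIV_chain2] 
          simp: flat_exp_def field_simps power2_eq_square)
    moreover have "eventually (\<lambda>s. s \<in> {0<..}) (nhds t)"
      using 1 by (intro eventually_nhds_in_open) auto
    then have "eventually (\<lambda>s. flat_exp p s = poly p (1 / s) * exp (- (1 / s))) (nhds t)"
      by eventually_elim (auto simp: flat_exp_def)
    ultimately show ?thesis
      by (subst DERIV_cong_ev[OF refl _ refl])
  next
    case 2
    have "eventually (\<lambda>s. s \<in> {..<0}) (nhds t)"
      using 2 by (intro eventually_nhds_in_open) auto
    then have "eventually (\<lambda>s. flat_exp p s = 0) (nhds t)"
      by eventually_elim (auto simp: flat_exp_def)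
    then show ?thesis
      using 2 by (subst DERIV_cong_ev[OF refl _ refl, of _ "\<lambda>_. 0"]) (auto simp: flat_exp_def)
  next
    case 3
    have "((\<lambda>h. flat_exp p h / h) \<longlongrightarrow> 0) (at_left 0)"
      by (rule tendsto_eventually)
        (auto simp: eventually_at_left_field flat_exp_def intro: exI[of _ "-1"])
    \<comment> \<open>For h > 0, division by h multiplies the polynomial by 1/h, so the quotient is
      again a flat function.\<close>
    moreover have "((\<lambda>h. flat_exp p h / h) \<longlongrightarrow> 0) (at_right 0)"
      using flat_exp_tendsto_0[of "[:0, 1:] * p"]
      by (rule Lim_transform_eventually)
        (auto simp: eventually_at_right_field flat_exp_def intro: exI[of _ 1])
    ultimately have "((\<lambda>h. flat_exp p h / h) \<longlongrightarrow> 0) (at 0)"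
      by (simp add: filterlim_split_at)
    then show ?thesis
      using 3 by (simp add: DERIV_def flat_exp_def)
  qed
qed

text \<open>This algebra is closed under partial derivatives, which gives the differentiability of all
  iterated ones.\<close>

inductive_set bump_algebra :: "real^3 \<Rightarrow> real \<Rightarrow> (real^3 \<Rightarrow> real) set" for a r where
  flat: "(\<lambda>x. flat_exp p (r - (x - a) \<bullet> (x - a))) \<in> bump_algebra a r"
| const: "(\<lambda>_. c) \<in> bump_algebra a r"
| coord: "(\<lambda>x. x $ i) \<in> bump_algebra a r"
| add: "\<phi> \<in> bump_algebra a r \<Longrightarrow> \<psi> \<in> bump_algebra a r \<Longrightarrow> (\<lambda>x. \<phi> x + \<psi> x) \<in> bump_algebra a r"
| mult: "\<phi> \<in> bump_algebra a r \<Longrightarrow> \<psi> \<in> bump_algebra a r \<Longrightarrow> (\<lambda>x. \<phi> x * \<psi> x) \<in> bump_algebra a r"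

lemma flat_exp_radial_has_derivative:
  fixes a x :: "'a::real_inner"
  shows "((\<lambda>x. flat_exp p (r - (x - a) \<bullet> (x - a))) has_derivative
    (\<lambda>h. - 2 * flat_exp ([:0, 0, 1:] * (p - pderiv p)) (r - (x - a) \<bullet> (x - a)) * ((x - a) \<bullet> h))) (at x)"
  by (rule has_derivative_eq_rhs, 
      rule has_derivative_compose[OF _ flat_exp_has_derivative[unfolded has_field_derivative_def]])
     (auto intro!: derivative_eq_intros simp: inner_commute fun_eq_iff)

text \<open>The induction must carry membership of the axis derivatives together with
  differentiability, since only membership allows iteration. Coordinates and constants are
  generators because the gradient of a flat generator contains the factor x - a.\<close>

lemma bump_algebra_has_derivative:
  assumes "\<phi> \<in> bump_algebra a r"
  shows "\<exists>D. (\<forall>x. (\<phi> has_derivative D x) (at x)) \<and> (\<forall>i. (\<lambda>x. D x (axis i 1)) \<in> bump_algebra a r)"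
  using assms
proof induction
  case (flat p)
  \<comment> \<open>The difference of coordinates is written as a sum with a constant to match the
    closure rules.\<close>
  have "(\<lambda>x. - 2 * flat_exp ([:0, 0, 1:] * (p - pderiv p)) (r - (x - a) \<bullet> (x - a)) * (x $ i + - (a $ i)))
      \<in> bump_algebra a r" for i
    by (intro bump_algebra.intros)
  then have "(\<lambda>x. - 2 * flat_exp ([:0, 0, 1:] * (p - pderiv p)) (r - (x - a) \<bullet> (x - a)) * ((x - a) \<bullet> axis i 1))
      \<in> bump_algebra a r" for i
    by (simp add: inner_axis)
  then show ?case
    by (intro exI conjI allI) (rule flat_exp_radial_has_derivative)
next
  case (const c)
  show ?case
    by (rule exI[of _ "\<lambda>x h. 0"]) (auto intro: bump_algebra.intros)
next
  case (coord i)
  show ?case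
    by (rule exI[of _ "\<lambda>x h. h $ i"])
      (auto intro: bump_algebra.intros bounded_linear_imp_has_derivative bounded_linear_vec_nth)
next
  case (add \<phi> \<psi>)
  then obtain D E where "\<forall>x. (\<phi> has_derivative D x) (at x)" "\<forall>i. (\<lambda>x. D x (axis i 1)) \<in> bump_algebra a r"
    "\<forall>x. (\<psi> has_derivative E x) (at x)" "\<forall>i. (\<lambda>x. E x (axis i 1)) \<in> bump_algebra a r"
    by blast
  then show ?case
    by (intro exI[of _ "\<lambda>x h. D x h + E x h"]) (auto intro: bump_algebra.intros has_derivative_add)
next
  case (mult \<phi> \<psi>)
  then obtain D E where "\<forall>x. (\<phi> has_derivative D x) (at x)" "\<forall>i. (\<lambda>x. D x (axis i 1)) \<in> bump_algebra a r"
    "\<forall>x. (\<psi> has_derivative E x) (at x)" "\<forall>i. (\<lambda>x. E x (axis i 1)) \<in> bump_algebra a r"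
    by blast
  with mult.hyps show ?case
    by (intro exI[of _ "\<lambda>x h. \<phi> x * E x h + D x h * \<psi> x"] conjI allI has_derivative_mult
        bump_algebra.add bump_algebra.mult) auto
qed

lemma partial_deriv_eq: "(\<phi> has_derivative D) (at x) \<Longrightarrow> partial_deriv i \<phi> x = D (axis i 1)"
  unfolding partial_deriv_def by (metis frechet_derivative_at)

lemma partial_deriv_bump_algebra:
  assumes "\<phi> \<in> bump_algebra a r"
  shows "partial_deriv i \<phi> \<in> bump_algebra a r"
proof -
  from bump_algebra_has_derivative[OF assms] obtain D
    where D: "\<forall>x. (\<phi> has_derivative D x) (at x)" "\<forall>i. (\<lambda>x. D x (axis i 1)) \<in> bump_algebra a r"
    by blast
  have "partial_deriv i \<phi> = (\<lambda>x. D x (axis i 1))"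
    using D(1) partial_deriv_eq by blast
  with D(2) show ?thesis by simp
qed

lemma foldr_partial_deriv_bump_algebra:
  "\<phi> \<in> bump_algebra a r \<Longrightarrow> foldr partial_deriv is \<phi> \<in> bump_algebra a r"
  by (induction "is") (auto intro: partial_deriv_bump_algebra)

section \<open>Radial bumps, their gradients and supports\<close>

text \<open>The standard mollifier exp(-1/(r^2 - |z|^2)) on the ball of radius |r|, without
  normalisation.\<close>

definition bump :: "real \<Rightarrow> real^3 \<Rightarrow> real" where
  "bump r z = flat_exp 1 (r\<^sup>2 - z \<bullet> z)"

text \<open>The i-th partial derivative of \<open>bump r\<close> in closed form, from the derivative
  rule with p = 1. This form makes oddness, continuity and support visible.\<close>

definition bump_grad :: "real \<Rightarrow> 3 \<Rightarrow> real^3 \<Rightarrow> real" where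
  "bump_grad r i z = - 2 * flat_exp [:0, 0, 1:] (r\<^sup>2 - z \<bullet> z) * z $ i"

lemma bump_test_function: "(\<lambda>y. bump r (y - a)) \<in> test_functions"
proof -
  have *: "(\<lambda>y. bump r (y - a)) \<in> bump_algebra a (r\<^sup>2)"
    unfolding bump_def by (rule bump_algebra.flat)
  have "{y. bump r (y - a) \<noteq> 0} \<subseteq> cball a \<bar>r\<bar>"
    by (auto simp: bump_def flat_exp_def dist_norm norm_minus_commute simp flip: power2_norm_eq_inner
        split: if_splits intro!: abs_le_square_iff[THEN iffD2, of "norm _", simplified])
  then have "bounded {y. bump r (y - a) \<noteq> 0}"
    by (rule bounded_subset[OF bounded_cball])
  moreover have "foldr partial_deriv is (\<lambda>y. bump r (y - a)) differentiable (at x)" for "is" x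
    unfolding differentiable_def
    using bump_algebra_has_derivative[OF foldr_partial_deriv_bump_algebra[OF *, of "is"]] by blast
  ultimately show ?thesis
    by (auto simp: test_functions_def)
qed

lemma partial_deriv_bump: "partial_deriv i (\<lambda>y. bump r (y - a)) y = bump_grad r i (y - a)"
  using partial_deriv_eq[OF flat_exp_radial_has_derivative[of 1 "r\<^sup>2" a y], of i]
  by (simp add: bump_def bump_grad_def inner_axis pderiv_1)

lemma bump_grad_uminus: "bump_grad r i (- z) = - bump_grad r i z"
  by (simp add: bump_grad_def)

lemma bump_pos: "norm z < r \<Longrightarrow> bump r z > 0"
  by (auto simp: bump_def flat_exp_def power_strict_mono simp flip: power2_norm_eq_inner)

lemma bump_nonneg: "bump r z \<ge> 0"
  by (auto simp: bump_def flat_exp_def)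

lemma bump_eq_0: "norm z \<ge> \<bar>r\<bar> \<Longrightarrow> bump r z = 0"
  using abs_le_square_iff[of r "norm z"]
  by (auto simp: bump_def flat_exp_def simp flip: power2_norm_eq_inner)

lemma bump_grad_eq_0: "norm z \<ge> \<bar>r\<bar> \<Longrightarrow> bump_grad r i z = 0"
  using abs_le_square_iff[of r "norm z"]
  by (auto simp: bump_grad_def flat_exp_def simp flip: power2_norm_eq_inner)

lemma continuous_on_flat_exp: "continuous_on S (flat_exp p)"
  using flat_exp_has_derivative DERIV_isCont continuous_at_imp_continuous_on by blast

lemma continuous_on_bump: "continuous_on S (bump r)"
  unfolding bump_def
  by (intro continuous_on_compose2[OF continuous_on_flat_exp[of UNIV]] continuous_intros) auto

lemma continuous_on_bump_grad: "continuous_on S (bump_grad r i)"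
  unfolding bump_grad_def
  by (intro continuous_intros continuous_on_compose2[OF continuous_on_flat_exp[of UNIV]]) auto

lemma integrable_continuous_compact_support:
  fixes h :: "'a::euclidean_space \<Rightarrow> real"
  assumes "continuous_on UNIV h" "\<And>z. norm z \<ge> R \<Longrightarrow> h z = 0"
  shows "integrable lborel h"
proof -
  have "integrable lborel (\<lambda>z. indicator (cball 0 R) z *\<^sub>R h z)"
    by (rule borel_integrable_compact) (auto intro: continuous_on_subset assms)
  also have "(\<lambda>z. indicator (cball 0 R) z *\<^sub>R h z) = h"
    using assms(2) by (auto simp: indicator_def fun_eq_iff)
  finally show ?thesis .
qed

lemma integrable_bump: "integrable lborel (bump r)"
  by (rule integrable_continuous_compact_support[OF continuous_on_bump bump_eq_0])

lemma integrable_bump_grad: "integrable lborel (bump_grad r i)"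
  by (rule integrable_continuous_compact_support[OF continuous_on_bump_grad bump_grad_eq_0])

section \<open>Translations of the periodicity cell\<close>

text \<open>Half-open, so that its integer translates tile the space without overlap;
  \<open>cube\<close> would miss the faces.\<close>

definition cell :: "(real^3) set" where
  "cell = {x. \<forall>i. 0 \<le> x $ i \<and> x $ i < 1}"

abbreviation cell_measure :: "(real^3) measure" where
  "cell_measure \<equiv> restrict_space lborel cell"

text \<open>Reduction modulo the integer lattice: the unique representative of a point in
  \<open>cell\<close>.\<close>

definition frac_vec :: "real^3 \<Rightarrow> real^3" where
  "frac_vec x = (\<chi> i. frac (x $ i))"

lemma borel_cell [measurable]: "cell \<in> sets borel"
proof -
  have "cell = (\<Inter>i\<in>UNIV. {x. 0 \<le> x $ i} \<inter> {x. x $ i < 1})"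
    by (auto simp: cell_def)
  also have "\<dots> \<in> sets borel"
    by (intro sets.countable_INT'' sets.Int borel_closed borel_open closed_Collect_le open_Collect_less
        continuous_intros) auto
  finally show ?thesis .
qed

lemma borel_measurable_frac_vec [measurable]: "frac_vec \<in> borel_measurable borel"
  by (rule borel_measurable_euclidean_space[THEN iffD2])
    (auto simp: frac_vec_def frac_def Basis_vec_def inner_axis)

lemma frac_vec_in_cell: "frac_vec x \<in> cell"
  by (simp add: cell_def frac_vec_def frac_lt_1)

lemma frac_vec_cell: "x \<in> cell \<Longrightarrow> frac_vec x = x"
  by (simp add: cell_def frac_vec_def vec_eq_iff frac_eq)

lemma frac_add_Ints: "k \<in> \<int> \<Longrightarrow> frac (x + k) = frac (x :: real)"
  by (auto elim!: Ints_cases simp: frac_def)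

text \<open>\<open>frac\<close> fixes [0,1) and ignores integer shifts, so only one lattice vector
  can bring x into the cell. This collapses a sum over the lattice to a single term.\<close>

lemma cell_add_iff:
  assumes "\<And>i. k $ i \<in> \<int>"
  shows "x + k \<in> cell \<longleftrightarrow> k = frac_vec x - x"
proof
  assume "x + k \<in> cell"
  then have "frac (x $ i + k $ i) = x $ i + k $ i" for i
    by (auto simp: cell_def frac_eq)
  moreover have "frac (x $ i + k $ i) = frac (x $ i)" for i
    using assms by (rule frac_add_Ints)
  ultimately show "k = frac_vec x - x"
    by (simp add: vec_eq_iff frac_vec_def algebra_simps)
next
  assume "k = frac_vec x - x"
  then show "x + k \<in> cell"
    by (simp add: frac_vec_in_cell)
qed

lemma frac_vec_add_Ints: "(\<And>i. k $ i \<in> \<int>) \<Longrightarrow> frac_vec (x + k) = frac_vec x"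
  by (simp add: vec_eq_iff frac_vec_def frac_add_Ints)

text \<open>Periodicity speaks of one forward unit step only. Integer induction in both directions
  handles multiples along an axis, and induction over the axes combines them.\<close>

lemma periodic_sum_axis:
  assumes "periodic v" "finite S"
  shows "v (x + (\<Sum>i\<in>S. of_int (m i) *\<^sub>R axis i 1)) = v x"
  using assms(2)
proof (induction arbitrary: x)
  case (insert i S)
  have "v (y + of_int k *\<^sub>R axis i 1) = v y" for y k
  proof (induction k rule: int_induct[of _ 0])
    case (step1 k)
    then show ?case
      using assms(1)[unfolded periodic_def, rule_format, of "y + of_int k *\<^sub>R axis i 1" i]
      by (simp add: algebra_simps)
  next
    case (step2 k)
    then show ?case
      using assms(1)[unfolded periodic_def, rule_format, of "y + of_int (k - 1) *\<^sub>R axis i 1" i]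
      by (simp add: algebra_simps)
  qed simp
  from this[of "x + (\<Sum>i\<in>S. of_int (m i) *\<^sub>R axis i 1)" "m i"] insert show ?case
    by (simp add: algebra_simps)
qed simp

lemma periodic_frac_vec:
  assumes "periodic v"
  shows "v (frac_vec x) = v x"
proof -
  have "x = frac_vec x + (\<Sum>i\<in>UNIV. of_int \<lfloor>x $ i\<rfloor> *\<^sub>R axis i 1)"
    by (simp add: vec_eq_iff frac_vec_def frac_def axis_def if_distrib cong: if_cong)
  then show ?thesis
    using periodic_sum_axis[OF assms, of UNIV "frac_vec x" "\<lambda>i. \<lfloor>x $ i\<rfloor>"] by simp
qed

lemma periodic_comp_frac_vec: "periodic (\<lambda>x. b (frac_vec x))"
  unfolding periodic_def by (subst frac_vec_add_Ints) (auto simp: axis_def)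

lemma emeasure_cell_finite: "emeasure lborel cell < \<infinity>"
proof -
  have "emeasure lborel cell \<le> emeasure lborel (cbox 0 (1::real^3))"
    by (intro emeasure_mono) (auto simp: cell_def mem_box_cart less_imp_le)
  then show ?thesis
    using emeasure_lborel_cbox_finite le_less_trans by blast
qed

lemma finite_measure_cell: "finite_measure cell_measure"
  using emeasure_cell_finite by (intro finite_measureI) (simp add: space_restrict_space emeasure_restrict_space)

interpretation cell: finite_measure cell_measure
  by (rule finite_measure_cell)

interpretation cell_lborel: pair_sigma_finite cell_measure lborel ..

section \<open>Translation invariance of integrals over the torus\<close>

lemma countable_Ints_vec: "countable {k::real^3. \<forall>i. k $ i \<in> \<int>}"
proof -
  have "{k::real^3. \<forall>i. k $ i \<in> \<int>} \<subseteq> vec_lambda ` (\<Pi>\<^sub>E i\<in>UNIV. \<int>)"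
    by (auto simp: image_iff PiE_def Pi_def extensional_def intro!: bexI[of _ "\<lambda>i. _ $ i"])
      (metis UNIV_I vec_lambda_eta)
  moreover have "countable (\<Pi>\<^sub>E i\<in>(UNIV::3 set). (\<int>::real set))"
    by (intro countable_PiE countable_int) auto
  ultimately show ?thesis
    using countable_image countable_subset by blast
qed

text \<open>Every point has exactly one translate by \<open>\<int>\<^sup>3\<close> in the cell.\<close>

lemma nn_integral_lattice_cell:
  "(\<integral>\<^sup>+k. indicator cell (x + k) \<partial>count_space {k::real^3. \<forall>i. k $ i \<in> \<int>}) = 1"
proof -
  have "(\<integral>\<^sup>+k. indicator cell (x + k) \<partial>count_space {k::real^3. \<forall>i. k $ i \<in> \<int>}) =
      (\<integral>\<^sup>+k. indicator {frac_vec x - x} k \<partial>count_space {k::real^3. \<forall>i. k $ i \<in> \<int>})"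
    by (intro nn_integral_cong) (auto simp: indicator_def cell_add_iff)
  also have "\<dots> = 1"
    by (subst nn_integral_indicator) (auto simp: frac_vec_def frac_def)
  finally show ?thesis .
qed

lemma nn_integral_lborel_translate:
  assumes "f \<in> borel_measurable (borel :: (real^3) measure)"
  shows "(\<integral>\<^sup>+x. f (x + c) \<partial>lborel) = (\<integral>\<^sup>+x. f x \<partial>lborel)"
proof -
  have "(\<integral>\<^sup>+x. f x \<partial>lborel) = (\<integral>\<^sup>+x. f x \<partial>distr lborel borel ((+) c))"
    by (simp add: lborel_distr_plus)
  also have "\<dots> = (\<integral>\<^sup>+x. f (x + c) \<partial>lborel)"
    using assms by (subst nn_integral_distr) (auto simp: add.commute)
  finally show ?thesis by simp
qed

text \<open>Unfolding over the lattice: insert the partition of unity by cell translates, exchange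
  sum and integral, shift by lattice vectors, under which the periodised function is invariant, and
  collapse the other partition of unity.\<close>

lemma nn_integral_cell_translate:
  assumes [measurable]: "f \<in> borel_measurable borel"
  shows "(\<integral>\<^sup>+x. f (frac_vec (x + z)) * indicator cell x \<partial>lborel) = (\<integral>\<^sup>+x. f x * indicator cell x \<partial>lborel)"
proof -
  define \<Lambda> where "\<Lambda> = {k::real^3. \<forall>i. k $ i \<in> \<int>}"
  note [simp] = countable_Ints_vec[folded \<Lambda>_def]
  let ?F = "\<lambda>x. f (frac_vec x)" and ?I = "\<lambda>x. indicator cell x :: ennreal"
  have per: "?F (x + k) = ?F x" if "k \<in> \<Lambda>" for x k
    using that by (subst frac_vec_add_Ints) (auto simp: \<Lambda>_def)
  have "(\<integral>\<^sup>+x. ?F (x + z) * ?I x \<partial>lborel) = (\<integral>\<^sup>+x. ?F x * ?I (x - z) \<partial>lborel)"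
    using nn_integral_lborel_translate[of "\<lambda>x. ?F x * ?I (x - z)" z] by simp
  \<comment> \<open>The inserted sum over k of \<open>?I (x + k)\<close> equals 1.\<close>
  also have "\<dots> = (\<integral>\<^sup>+x. \<integral>\<^sup>+k. ?F x * ?I (x - z) * ?I (x + k) \<partial>count_space \<Lambda> \<partial>lborel)"
    by (simp add: nn_integral_cmult nn_integral_lattice_cell[folded \<Lambda>_def])
  also have "\<dots> = (\<integral>\<^sup>+k. \<integral>\<^sup>+x. ?F x * ?I (x - z) * ?I (x + k) \<partial>lborel \<partial>count_space \<Lambda>)"
    by (rule nn_integral_count_space_nn_integral) auto
  also have "\<dots> = (\<integral>\<^sup>+k. \<integral>\<^sup>+x. ?F (x + (- k)) * ?I (x + (- k) - z) * ?I (x + (- k) + k) \<partial>lborel \<partial>count_space \<Lambda>)"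
    by (subst nn_integral_lborel_translate[where f="\<lambda>x. ?F x * ?I (x - z) * ?I (x + _)"]) auto
  also have "\<dots> = (\<integral>\<^sup>+k. \<integral>\<^sup>+x. ?F x * ?I x * ?I (- z + x + (- k)) \<partial>lborel \<partial>count_space \<Lambda>)"
    by (intro nn_integral_cong) (subst per, auto simp: \<Lambda>_def ac_simps diff_diff_add)
  also have "\<dots> = (\<integral>\<^sup>+x. \<integral>\<^sup>+k. ?F x * ?I x * ?I (- z + x + (- k)) \<partial>count_space \<Lambda> \<partial>lborel)"
    by (rule nn_integral_count_space_nn_integral[symmetric]) auto
  \<comment> \<open>Reflecting the lattice puts the remaining sum into the form of the partition of
    unity.\<close>
  also have "\<dots> = (\<integral>\<^sup>+x. \<integral>\<^sup>+k. ?F x * ?I x * ?I (- z + x + k) \<partial>count_space \<Lambda> \<partial>lborel)"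
    by (intro nn_integral_cong nn_integral_bij_count_space[where g=uminus, symmetric, THEN sym] 
        bij_betwI[where g=uminus]) (auto simp: \<Lambda>_def)
  also have "\<dots> = (\<integral>\<^sup>+x. ?F x * ?I x \<partial>lborel)"
    by (simp add: nn_integral_cmult nn_integral_lattice_cell[folded \<Lambda>_def])
  also have "\<dots> = (\<integral>\<^sup>+x. f x * ?I x \<partial>lborel)"
    by (intro nn_integral_cong) (auto simp: indicator_def frac_vec_cell)
  finally show ?thesis .
qed

lemma measurable_frac_vec_cell [measurable]:
  "(\<lambda>x. frac_vec (x + z)) \<in> cell_measure \<rightarrow>\<^sub>M cell_measure"
  by (intro measurable_restrict_space2 measurable_restrict_space1) (auto simp: frac_vec_in_cell)

text \<open>The previous identity at indicators. As an equality of measures it yields both values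
  and integrability of signed integrands.\<close>

lemma distr_cell_translate: "distr cell_measure cell_measure (\<lambda>x. frac_vec (x + z)) = cell_measure"
proof (rule measure_eqI)
  fix A assume "A \<in> sets (distr cell_measure cell_measure (\<lambda>x. frac_vec (x + z)))"
  then have A: "A \<subseteq> cell" "A \<in> sets borel" "A \<in> sets cell_measure"
    by (auto simp: sets_restrict_space)
  note [measurable] = A(2)
  have "emeasure (distr cell_measure cell_measure (\<lambda>x. frac_vec (x + z))) A =
      (\<integral>\<^sup>+x. indicator A x \<partial>distr cell_measure cell_measure (\<lambda>x. frac_vec (x + z)))"
    using A by simp
  also have "\<dots> = (\<integral>\<^sup>+x. indicator A (frac_vec (x + z)) \<partial>cell_measure)"
    by (rule nn_integral_distr) (use A in measurable)
  also have "\<dots> = (\<integral>\<^sup>+x. indicator A x \<partial>cell_measure)"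
    using nn_integral_cell_translate[of "indicator A" z] by (simp add: nn_integral_restrict_space)
  also have "\<dots> = emeasure cell_measure A"
    using A by simp
  finally show "emeasure (distr cell_measure cell_measure (\<lambda>x. frac_vec (x + z))) A = emeasure cell_measure A" .
qed simp

lemma borel_measurable_cell [measurable (raw)]:
  "f \<in> borel_measurable borel \<Longrightarrow> f \<in> borel_measurable cell_measure"
  by (simp add: measurable_restrict_space1)

lemma integral_cell_translate:
  fixes F :: "real^3 \<Rightarrow> real"
  assumes "periodic F" and [measurable]: "F \<in> borel_measurable borel"
  shows "(\<integral>x. F (x + z) \<partial>cell_measure) = (\<integral>x. F x \<partial>cell_measure)"
    and "integrable cell_measure (\<lambda>x. F (x + z)) \<longleftrightarrow> integrable cell_measure F"
proof -
  have F: "(\<lambda>x. F (x + z)) = (\<lambda>x. F (frac_vec (x + z)))"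
    by (simp add: periodic_frac_vec[OF assms(1)])
  have "(\<integral>x. F x \<partial>cell_measure) = (\<integral>x. F x \<partial>distr cell_measure cell_measure (\<lambda>x. frac_vec (x + z)))"
    by (simp add: distr_cell_translate)
  also have "\<dots> = (\<integral>x. F (x + z) \<partial>cell_measure)"
    unfolding F by (rule integral_distr) measurable
  finally show "(\<integral>x. F (x + z) \<partial>cell_measure) = (\<integral>x. F x \<partial>cell_measure)" ..
  have "integrable cell_measure F \<longleftrightarrow> integrable (distr cell_measure cell_measure (\<lambda>x. frac_vec (x + z))) F"
    by (simp add: distr_cell_translate)
  also have "\<dots> \<longleftrightarrow> integrable cell_measure (\<lambda>x. F (x + z))"
    unfolding F by (rule integrable_distr_eq) measurable
  finally show "integrable cell_measure (\<lambda>x. F (x + z)) \<longleftrightarrow> integrable cell_measure F" ..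
qed

section \<open>Continuity of correlations\<close>

text \<open>The exceptional points lie on countably many hyperplanes. Away from them
  \<open>cell\<close> and \<open>cube\<close> agree.\<close>

lemma AE_lborel_not_Ints: "AE x in lborel. \<forall>i. (x::real^3) $ i \<notin> \<int>"
proof -
  have "AE x in lborel. (x::real^3) $ i \<noteq> c" for i c
  proof -
    have "negligible {x::real^3. axis i 1 \<bullet> x = c}"
      by (rule negligible_hyperplane) auto
    then have "AE x in lebesgue. (x::real^3) $ i \<noteq> c"
      by (auto simp: negligible_iff_null_sets inner_axis' intro: AE_I')
    then show ?thesis
      by (simp add: AE_completion_iff)
  qed
  then have "AE x in lborel. \<forall>c\<in>\<int>. (x::real^3) $ i \<noteq> c" for i
    by (simp add: AE_ball_countable countable_int)
  then have "AE x in lborel. (x::real^3) $ i \<notin> \<int>" for i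
    by (rule eventually_mono) auto
  then show ?thesis
    by (simp add: AE_all_countable)
qed

lemma cell_not_Ints: "x \<in> cell \<Longrightarrow> \<forall>i. x $ i \<notin> \<int> \<Longrightarrow> x \<in> cube"
  by (auto simp: cell_def cube_def) (metis Ints_0 order_le_less)

lemma cube_subset_cell: "cube \<subseteq> cell"
  by (auto simp: cell_def cube_def less_imp_le)

lemma AE_cell_in_cube: "AE x in cell_measure. x \<in> cube"
  using AE_lborel_not_Ints cell_not_Ints by (subst AE_restrict_space_iff) (auto elim!: eventually_mono)

lemma open_cube: "open cube"
proof -
  have "cube = (\<Inter>i\<in>UNIV. {x. 0 < x $ i} \<inter> {x. x $ i < 1})"
    by (auto simp: cube_def)
  also have "open \<dots>"
    by (auto intro!: open_INT open_Int open_Collect_less continuous_intros)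
  finally show ?thesis .
qed

section \<open>Young's inequality and approximation in L2\<close>

lemma L2_D:
  assumes "f \<in> L2 M"
  shows "f \<in> borel_measurable M" "integrable M (\<lambda>x. (f x)\<^sup>2)"
  using assms by (auto simp: L2_def)

text \<open>Young's inequality from a completed square. The free weight \<open>t\<close> is made
  large in the continuity proof and matched to the damping in the energy estimate.\<close>

lemma mult_le_sum_squares: "t > 0 \<Longrightarrow> \<bar>a * b\<bar> \<le> t * a\<^sup>2 + b\<^sup>2 / (4 * t)" for a b t :: real
proof -
  assume t: "t > 0"
  have "0 \<le> (2 * t * \<bar>a\<bar> - \<bar>b\<bar>)\<^sup>2" by simp
  also have "\<dots> = 4 * t * (t * a\<^sup>2 + b\<^sup>2 / (4 * t) - \<bar>a * b\<bar>)"
    using t by (simp add: power2_eq_square field_simps abs_mult)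
  finally show ?thesis
    using t by (simp add: zero_le_mult_iff)
qed

lemma integrable_mult_L2:
  assumes "f \<in> L2 M" "g \<in> L2 M"
  shows "integrable M (\<lambda>x. f x * g x)"
proof (rule Bochner_Integration.integrable_bound)
  show "integrable M (\<lambda>x. (f x)\<^sup>2 + (g x)\<^sup>2)"
    using assms by (auto dest: L2_D)
  show "(\<lambda>x. f x * g x) \<in> borel_measurable M"
    using assms[THEN L2_D(1)] by measurable
  have "\<bar>a * b\<bar> \<le> a\<^sup>2 + b\<^sup>2" for a b :: real
    using mult_le_sum_squares[of 1 a b] by (auto intro: order_trans)
  then show "AE x in M. norm (f x * g x) \<le> norm ((f x)\<^sup>2 + (g x)\<^sup>2)"
    by auto
qed

lemma L2_diff:
  assumes "f \<in> L2 M" "g \<in> L2 M"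
  shows "(\<lambda>x. f x - g x) \<in> L2 M"
  using assms integrable_mult_L2[OF assms]
  by (auto simp: L2_def power2_diff mult.assoc)

lemma bounded_in_L2_cell:
  assumes "f \<in> borel_measurable borel" "\<And>x. \<bar>f x\<bar> \<le> B"
  shows "f \<in> L2 cell_measure"
  unfolding L2_def
proof safe
  have "(f x)\<^sup>2 \<le> B\<^sup>2" for x
    using assms(2)[of x] by (metis abs_ge_zero power2_abs power_mono)
  then show "integrable cell_measure (\<lambda>x. (f x)\<^sup>2)"
    using assms(1) by (intro cell.integrable_const_bound[of _ "B\<^sup>2"]) auto
qed (use assms in simp)

text \<open>Truncation to [-M, M]. It preserves continuity and supplies constant dominating
  functions.\<close>

definition clip :: "real \<Rightarrow> real \<Rightarrow> real" where
  "clip M x = max (- M) (min M x)"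

lemma abs_clip_le: "M \<ge> 0 \<Longrightarrow> \<bar>clip M x\<bar> \<le> M"
  by (auto simp: clip_def)

lemma abs_diff_clip_le: "M \<ge> 0 \<Longrightarrow> \<bar>x - clip M x\<bar> \<le> \<bar>x\<bar>"
  by (auto simp: clip_def)

lemma clip_eq: "\<bar>x\<bar> \<le> M \<Longrightarrow> clip M x = x"
  by (auto simp: clip_def)

lemma borel_measurable_clip [measurable]: "clip M \<in> borel_measurable borel"
  unfolding clip_def by measurable

lemma tendsto_clip [tendsto_intros]: "(f \<longlongrightarrow> l) F \<Longrightarrow> ((\<lambda>x. clip M (f x)) \<longlongrightarrow> clip M l) F"
  unfolding clip_def by (intro tendsto_intros)

lemma continuous_on_clip [continuous_intros]: "continuous_on S f \<Longrightarrow> continuous_on S (\<lambda>x. clip M (f x))"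
  unfolding clip_def by (intro continuous_intros)

lemma clip_approx_L2_cell:
  assumes [measurable]: "u \<in> borel_measurable borel" and u: "u \<in> L2 cell_measure" and "e > 0"
  shows "\<exists>n::nat. (\<integral>x. (u x - clip n (u x))\<^sup>2 \<partial>cell_measure) < e"
proof -
  have "(\<lambda>n. \<integral>x. (u x - clip (real n) (u x))\<^sup>2 \<partial>cell_measure) \<longlonglongrightarrow> (\<integral>x. 0 \<partial>cell_measure)"
  proof (rule integral_dominated_convergence[where w="\<lambda>x. (u x)\<^sup>2"])
    show "AE x in cell_measure. (\<lambda>n. (u x - clip (real n) (u x))\<^sup>2) \<longlonglongrightarrow> 0"
    proof (rule AE_I2)
      fix x
      obtain m :: nat where m: "\<bar>u x\<bar> \<le> m" using real_arch_simple by blast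
      have "eventually (\<lambda>n. (u x - clip (real n) (u x))\<^sup>2 = 0) sequentially"
        using eventually_ge_at_top[of m] by eventually_elim (use m in \<open>auto simp: clip_eq\<close>)
      then show "(\<lambda>n. (u x - clip (real n) (u x))\<^sup>2) \<longlonglongrightarrow> 0"
        by (rule tendsto_eventually)
    qed
    show "integrable cell_measure (\<lambda>x. (u x)\<^sup>2)"
      using u by (rule L2_D)
    show "AE x in cell_measure. norm ((u x - clip (real n) (u x))\<^sup>2) \<le> (u x)\<^sup>2" for n
      by (simp add: abs_le_square_iff[symmetric] abs_diff_clip_le)
  qed measurable
  then have "eventually (\<lambda>n. (\<integral>x. (u x - clip (real n) (u x))\<^sup>2 \<partial>cell_measure) < e) sequentially"
    using \<open>e > 0\<close> by (intro order_tendstoD) auto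
  then show ?thesis
    by (rule eventually_happens'[rotated]) simp
qed

text \<open>A measurable function is an almost everywhere limit of continuous ones. Truncating both
  at the same level makes dominated convergence applicable.\<close>

lemma continuous_approx_L2_cell:
  assumes [measurable]: "u \<in> borel_measurable borel" and u: "u \<in> L2 cell_measure" and "e > 0"
  shows "\<exists>w M. continuous_on UNIV w \<and> (\<forall>x. \<bar>w x\<bar> \<le> M) \<and> (\<integral>x. (u x - w x)\<^sup>2 \<partial>cell_measure) < e"
proof -
  \<comment> \<open>Two errors below e/4 suffice, as (a + b)^2 \<le> 2 a^2 + 2 b^2.\<close>
  obtain n :: nat where n: "(\<integral>x. (u x - clip n (u x))\<^sup>2 \<partial>cell_measure) < e / 4"
    using clip_approx_L2_cell[OF assms(1,2), of "e / 4"] \<open>e > 0\<close> by auto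
  have "u measurable_on UNIV"
    using measurable_on_iff_borel_measurable[of UNIV u] assms(1)
    by (simp add: measurable_completion lebesgue_on_UNIV_eq)
  \<comment> \<open>\<open>measurable_on\<close> unfolds to continuous functions converging off a
    negligible set.\<close>
  then obtain N g where N: "negligible N" and g: "\<And>k. continuous_on UNIV (g k)"
      "\<And>x. x \<notin> N \<Longrightarrow> (\<lambda>k. g k x) \<longlonglongrightarrow> u x"
    by (auto simp: measurable_on_def)
  have [measurable]: "g k \<in> borel_measurable borel" for k
    using g(1) by (simp add: borel_measurable_continuous_onI)
  have "AE x in lebesgue. x \<notin> N"
    using N by (auto simp: negligible_iff_null_sets intro: AE_not_in)
  then have "AE x in lborel. (\<lambda>k. g k x) \<longlonglongrightarrow> u x"
    unfolding AE_completion_iff by eventually_elim (rule g(2))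
  then have ae: "AE x in cell_measure. (\<lambda>k. g k x) \<longlonglongrightarrow> u x"
    by (subst AE_restrict_space_iff) (auto elim: eventually_mono)
  have "(\<lambda>k. \<integral>x. (clip n (u x) - clip n (g k x))\<^sup>2 \<partial>cell_measure) \<longlonglongrightarrow> (\<integral>x. 0 \<partial>cell_measure)"
  proof (rule integral_dominated_convergence[where w="\<lambda>x. (2 * real n)\<^sup>2"])
    show "AE x in cell_measure. (\<lambda>k. (clip n (u x) - clip n (g k x))\<^sup>2) \<longlonglongrightarrow> 0"
      using ae
    proof eventually_elim
      fix x assume "(\<lambda>k. g k x) \<longlonglongrightarrow> u x"
      then have "(\<lambda>k. (clip n (u x) - clip n (g k x))\<^sup>2) \<longlonglongrightarrow> (clip n (u x) - clip n (u x))\<^sup>2"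
        by (intro tendsto_intros)
      then show "(\<lambda>k. (clip n (u x) - clip n (g k x))\<^sup>2) \<longlonglongrightarrow> 0" by simp
    qed
    have "\<bar>clip (real n) (u x) - clip (real n) (g k x)\<bar> \<le> \<bar>2 * real n\<bar>" for k x
      using abs_clip_le[of "real n" "u x"] abs_clip_le[of "real n" "g k x"] by linarith
    then show "AE x in cell_measure. norm ((clip n (u x) - clip n (g k x))\<^sup>2) \<le> (2 * real n)\<^sup>2" for k
      by (simp only: abs_le_square_iff real_norm_def power2_abs abs_power2) simp
  qed simp_all
  then have "eventually (\<lambda>k. (\<integral>x. (clip n (u x) - clip n (g k x))\<^sup>2 \<partial>cell_measure) < e / 4) sequentially"
    using \<open>e > 0\<close> by (intro order_tendstoD) auto
  then obtain k where k: "(\<integral>x. (clip n (u x) - clip n (g k x))\<^sup>2 \<partial>cell_measure) < e / 4"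
    using eventually_happens'[OF sequentially_bot] by blast
  define w where "w x = clip n (g k x)" for x
  have w: "continuous_on UNIV w" "\<bar>w x\<bar> \<le> n" for x
    unfolding w_def by (auto intro!: continuous_intros g abs_clip_le)
  have L2: "w \<in> L2 cell_measure" "(\<lambda>x. clip n (u x)) \<in> L2 cell_measure"
    unfolding w_def by (rule bounded_in_L2_cell[of _ "real n"]; simp add: abs_clip_le)+
  note int = L2_D(2)[OF L2_diff[OF u L2(1)]] L2_D(2)[OF L2_diff[OF u L2(2)]] L2_D(2)[OF L2_diff[OF L2(2,1)]]
  have "(\<integral>x. (u x - w x)\<^sup>2 \<partial>cell_measure) \<le>
      (\<integral>x. 2 * (u x - clip n (u x))\<^sup>2 + 2 * (clip n (u x) - w x)\<^sup>2 \<partial>cell_measure)"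
  proof (rule integral_mono)
    fix x
    have "0 \<le> ((u x - clip n (u x)) - (clip n (u x) - w x))\<^sup>2" by simp
    then show "(u x - w x)\<^sup>2 \<le> 2 * (u x - clip n (u x))\<^sup>2 + 2 * (clip n (u x) - w x)\<^sup>2"
      by (simp add: power2_eq_square algebra_simps)
  qed (use int in auto)
  also have "\<dots> < e"
    using int n k by (simp add: w_def)
  finally show ?thesis
    using w by blast
qed

section \<open>Correlations of periodic functions\<close>

text \<open>Cross-correlation on the torus. The first factor is evaluated in the cell only, the
  second also outside it.\<close>

definition corr :: "(real^3 \<Rightarrow> real) \<Rightarrow> (real^3 \<Rightarrow> real) \<Rightarrow> real^3 \<Rightarrow> real" where
  "corr u v z = (\<integral>a. u a * v (a + z) \<partial>cell_measure)"

text \<open>Borel rather than Lebesgue measurability, so that \<open>v (a + z)\<close> is measurable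
  jointly in \<open>a\<close> and \<open>z\<close>.\<close>

definition periodic_L2 :: "(real^3 \<Rightarrow> real) \<Rightarrow> bool" where
  "periodic_L2 v \<longleftrightarrow> v \<in> borel_measurable borel \<and> periodic v \<and> v \<in> L2 cell_measure"

lemma periodic_minus: "periodic v \<Longrightarrow> periodic (\<lambda>x. v (x - z))"
  unfolding periodic_def by (metis add_diff_eq add.commute)

lemma periodic_mult: "periodic u \<Longrightarrow> periodic v \<Longrightarrow> periodic (\<lambda>x. u x * v x)"
  by (simp add: periodic_def)

lemma L2_translate:
  assumes "periodic_L2 v"
  shows "(\<lambda>a. v (a + z)) \<in> L2 cell_measure"
    and "(\<integral>a. (v (a + z))\<^sup>2 \<partial>cell_measure) = (\<integral>a. (v a)\<^sup>2 \<partial>cell_measure)"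
proof -
  from assms have [measurable]: "v \<in> borel_measurable borel"
    and v: "periodic (\<lambda>x. (v x)\<^sup>2)" "integrable cell_measure (\<lambda>x. (v x)\<^sup>2)"
    by (auto simp: periodic_L2_def periodic_def L2_def)
  show "(\<lambda>a. v (a + z)) \<in> L2 cell_measure"
    using v by (auto simp: L2_def integral_cell_translate(2)[OF v(1)])
  show "(\<integral>a. (v (a + z))\<^sup>2 \<partial>cell_measure) = (\<integral>a. (v a)\<^sup>2 \<partial>cell_measure)"
    by (rule integral_cell_translate(1)[OF v(1)]) measurable
qed

text \<open>Weighted Young inequality under the integral. The bound is uniform in \<open>z\<close>
  because translation preserves the L2 norm of \<open>v\<close>.\<close>

lemma corr_bound:
  assumes "u \<in> L2 cell_measure" "periodic_L2 v" "t > 0"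
  shows "\<bar>corr u v z\<bar> \<le> t * (\<integral>a. (u a)\<^sup>2 \<partial>cell_measure) + (\<integral>a. (v a)\<^sup>2 \<partial>cell_measure) / (4 * t)"
proof -
  note v = L2_translate[OF assms(2), of z]
  have "\<bar>corr u v z\<bar> \<le> (\<integral>a. \<bar>u a * v (a + z)\<bar> \<partial>cell_measure)"
    unfolding corr_def by (rule integral_abs_bound)
  also have "\<dots> \<le> (\<integral>a. t * (u a)\<^sup>2 + (v (a + z))\<^sup>2 / (4 * t) \<partial>cell_measure)"
    by (intro integral_mono integrable_abs integrable_mult_L2 mult_le_sum_squares
        Bochner_Integration.integrable_add integrable_mult_right integrable_divide)
      (use assms v in \<open>auto dest: L2_D\<close>)
  also have "\<dots> = t * (\<integral>a. (u a)\<^sup>2 \<partial>cell_measure) + (\<integral>a. (v a)\<^sup>2 \<partial>cell_measure) / (4 * t)"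
    using L2_D(2)[OF assms(1)] L2_D(2)[OF v(1)] v(2) by simp
  finally show ?thesis .
qed

lemma corr_diff_left:
  assumes "u \<in> L2 cell_measure" "w \<in> L2 cell_measure" "periodic_L2 v"
  shows "corr (\<lambda>a. u a - w a) v z = corr u v z - corr w v z"
  using integrable_mult_L2[OF assms(1) L2_translate(1)[OF assms(3), of z]]
    integrable_mult_L2[OF assms(2) L2_translate(1)[OF assms(3), of z]]
  by (simp add: corr_def left_diff_distrib)

text \<open>Moves the shift from \<open>v\<close> to \<open>w\<close>, so that a limit in
  \<open>z\<close> only concerns the factor that will be continuous. As \<open>w\<close> need not be
  periodic, it is periodised by \<open>frac_vec\<close>.\<close>

lemma corr_eq_periodic:
  assumes [measurable]: "w \<in> borel_measurable borel" and v: "periodic_L2 v"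
  shows "corr w v z = (\<integral>a. w (frac_vec (a - z)) * v a \<partial>cell_measure)"
proof -
  from v have [measurable]: "v \<in> borel_measurable borel" and "periodic v"
    by (auto simp: periodic_L2_def)
  then have "periodic (\<lambda>a. w (frac_vec (a - z)) * v a)"
    by (intro periodic_mult periodic_minus[OF periodic_comp_frac_vec])
  from integral_cell_translate(1)[OF this, of z]
  have "(\<integral>a. w (frac_vec (a - z)) * v a \<partial>cell_measure) = (\<integral>a. w (frac_vec a) * v (a + z) \<partial>cell_measure)"
    by simp
  also have "\<dots> = corr w v z"
    unfolding corr_def
    by (intro Bochner_Integration.integral_cong) (auto simp: space_restrict_space frac_vec_cell)
  finally show ?thesis ..
qed

text \<open>The periodised \<open>w\<close> may jump across the faces, but almost every point is
  interior to the cell, and small shifts keep it there. Dominated convergence then applies.\<close>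

lemma corr_continuous_left:
  assumes w: "continuous_on UNIV w" "\<And>x. \<bar>w x\<bar> \<le> M" and v: "periodic_L2 v"
  shows "isCont (corr w v) 0"
  unfolding continuous_at_sequentially
proof (safe, unfold o_def)
  fix X :: "nat \<Rightarrow> real^3" assume X: "X \<longlonglongrightarrow> 0"
  have [measurable]: "w \<in> borel_measurable borel" "v \<in> borel_measurable borel"
    using w v by (auto simp: periodic_L2_def borel_measurable_continuous_onI)
  have "(\<lambda>n. \<integral>a. w (frac_vec (a - X n)) * v a \<partial>cell_measure) \<longlonglongrightarrow> (\<integral>a. w (frac_vec (a - 0)) * v a \<partial>cell_measure)"
  proof (rule integral_dominated_convergence[where w="\<lambda>x. M * \<bar>v x\<bar>"])
    show "AE a in cell_measure. (\<lambda>n. w (frac_vec (a - X n)) * v a) \<longlonglongrightarrow> w (frac_vec (a - 0)) * v a"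
      using AE_cell_in_cube
    proof eventually_elim
      fix a assume a: "a \<in> cube"
      have lim: "(\<lambda>n. a - X n) \<longlonglongrightarrow> a"
        using tendsto_diff[OF tendsto_const X] by simp
      have "isCont w a"
        using w(1) by (simp add: continuous_on_eq_continuous_at)
      then have "(\<lambda>n. w (a - X n)) \<longlonglongrightarrow> w a"
        using lim by (rule isCont_tendsto_compose)
      moreover have "eventually (\<lambda>n. a - X n \<in> cube) sequentially"
        using lim open_cube a by (rule topological_tendstoD)
      then have "eventually (\<lambda>n. w (a - X n) = w (frac_vec (a - X n))) sequentially"
        by eventually_elim (use cube_subset_cell frac_vec_cell in auto)
      ultimately have "(\<lambda>n. w (frac_vec (a - X n))) \<longlonglongrightarrow> w a"
        by (rule Lim_transform_eventually)
      moreover have "frac_vec (a - 0) = a"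
        using a cube_subset_cell frac_vec_cell by auto
      ultimately show "(\<lambda>n. w (frac_vec (a - X n)) * v a) \<longlonglongrightarrow> w (frac_vec (a - 0)) * v a"
        by (intro tendsto_intros) simp
    qed
    \<comment> \<open>On a finite measure space an L2 function is integrable: pair it with the
      constant 1.\<close>
    have "integrable cell_measure (\<lambda>x. 1 * v x)"
      using v by (intro integrable_mult_L2[OF bounded_in_L2_cell[of "\<lambda>_. 1" 1]]) (auto simp: periodic_L2_def)
    then show "integrable cell_measure (\<lambda>x. M * \<bar>v x\<bar>)"
      by simp
    show "AE a in cell_measure. norm (w (frac_vec (a - X n)) * v a) \<le> M * \<bar>v a\<bar>" for n
      using w(2) by (auto simp: abs_mult intro!: mult_right_mono)
  qed measurable
  then show "(\<lambda>n. corr w v (X n)) \<longlonglongrightarrow> corr w v 0"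
    using v by (simp add: corr_eq_periodic)
qed

text \<open>Replace \<open>u\<close> by a bounded continuous \<open>w\<close>. The error is small
  uniformly in the shift by \<open>corr_bound\<close>, and the correlation of \<open>w\<close> is
  continuous at 0.\<close>

lemma isCont_corr:
  assumes [measurable]: "u \<in> borel_measurable borel" and u: "u \<in> L2 cell_measure" and v: "periodic_L2 v"
  shows "isCont (corr u v) 0"
  unfolding isCont_def
proof (rule tendstoI)
  fix e :: real assume "e > 0"
  define V where "V = (\<integral>a. (v a)\<^sup>2 \<partial>cell_measure)"
  have "V \<ge> 0" by (simp add: V_def)
  \<comment> \<open>Large enough for V/(4t) < e/4, and positive even if V = 0. Accuracy e/(16t) for
    \<open>w\<close> then gives an error below 5e/16 at each of the two shifts; with e/16 from
    continuity the total stays below e.\<close>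
  define t where "t = (V + 1) / e"
  have "t > 0"
    using \<open>V \<ge> 0\<close> \<open>e > 0\<close> by (simp add: t_def)
  have "t * e = V + 1"
    using \<open>e > 0\<close> by (simp add: t_def)
  then have "V / (4 * t) < e / 4"
    using \<open>t > 0\<close> by (simp add: field_simps)
  note t = \<open>t > 0\<close> this
  obtain w M where w: "continuous_on UNIV w" "\<And>x. \<bar>w x\<bar> \<le> M"
      "(\<integral>x. (u x - w x)\<^sup>2 \<partial>cell_measure) < e / (16 * t)"
    using continuous_approx_L2_cell[OF assms(1) u, of "e / (16 * t)"] t \<open>e > 0\<close> by auto
  have [measurable]: "w \<in> borel_measurable borel"
    using w(1) by (rule borel_measurable_continuous_onI)
  have wL2: "w \<in> L2 cell_measure"
    by (rule bounded_in_L2_cell[OF _ w(2)]) measurable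
  have "t * (\<integral>x. (u x - w x)\<^sup>2 \<partial>cell_measure) < e / 16"
    using w(3) t by (simp add: field_simps)
  then have *: "\<bar>corr u v z - corr w v z\<bar> < 5 * e / 16" for z
    using corr_bound[OF L2_diff[OF u wL2] v t(1), of z] t(2) corr_diff_left[OF u wL2 v, of z]
    by (simp add: V_def)
  have "eventually (\<lambda>z. dist (corr w v z) (corr w v 0) < e / 16) (at 0)"
    using corr_continuous_left[OF w(1,2) v] \<open>e > 0\<close> unfolding isCont_def by (intro tendstoD) auto
  then show "eventually (\<lambda>z. dist (corr u v z) (corr u v 0) < e) (at 0)"
  proof eventually_elim
    fix z assume "dist (corr w v z) (corr w v 0) < e / 16"
    with *[of 0] *[of z] \<open>e > 0\<close> show "dist (corr u v z) (corr u v 0) < e"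
      unfolding dist_real_def by linarith
  qed
qed

text \<open>Translation by \<open>z\<close> in the periodic integrand u(a) v(a - z); here both
  factors must be periodic.\<close>

lemma corr_uminus:
  assumes "periodic_L2 u" "periodic_L2 v"
  shows "corr u v (- z) = corr v u z"
proof -
  have [measurable]: "u \<in> borel_measurable borel" "v \<in> borel_measurable borel"
    and "periodic u" "periodic v"
    using assms by (auto simp: periodic_L2_def)
  then have "periodic (\<lambda>a. u a * v (a - z))"
    by (intro periodic_mult periodic_minus)
  from integral_cell_translate(1)[OF this, of z] show ?thesis
    by (simp add: corr_def mult.commute)
qed

text \<open>Dominated by (u(a)^2 + v(a + z)^2) |\<psi>(z)|. Integrated over \<open>a\<close> first,
  this is a constant times |\<psi>(z)| by translation invariance, hence the work on the swapped
  product.\<close>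

lemma integrable_cell_lborel:
  assumes [measurable]: "u \<in> borel_measurable borel" and u: "u \<in> L2 cell_measure" and v: "periodic_L2 v"
    and \<psi>: "integrable lborel \<psi>"
  shows "integrable (cell_measure \<Otimes>\<^sub>M lborel) (\<lambda>(a, z). u a * v (a + z) * \<psi> z)"
proof -
  have [measurable]: "v \<in> borel_measurable borel" "\<psi> \<in> borel_measurable borel"
    using v \<psi> by (auto simp: periodic_L2_def)
  have [measurable]: "(\<lambda>x. h (fst x)) \<in> borel_measurable (cell_measure \<Otimes>\<^sub>M lborel)"
      "(\<lambda>x. h (snd x)) \<in> borel_measurable (lborel \<Otimes>\<^sub>M cell_measure)"
    if "h \<in> borel_measurable borel" for h :: "real^3 \<Rightarrow> real"
    using that by (auto intro: measurable_compose[OF measurable_fst] measurable_compose[OF measurable_snd])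
  have [measurable]: "snd \<in> borel_measurable (lborel \<Otimes>\<^sub>M cell_measure)"
    by (rule measurable_compose[OF measurable_snd]) (simp add: measurable_restrict_space1)
  interpret Q: pair_sigma_finite lborel cell_measure ..
  let ?g = "\<lambda>(z, a). ((u a)\<^sup>2 + (v (a + z))\<^sup>2) * \<psi> z"
  have g: "integrable (lborel \<Otimes>\<^sub>M cell_measure) ?g"
  proof (rule Q.Fubini_integrable)
    have i: "integrable cell_measure (\<lambda>a. (u a)\<^sup>2 + (v (a + z))\<^sup>2)" for z
      using L2_D(2)[OF u] L2_D(2)[OF L2_translate(1)[OF v]] by simp
    then show "AE z in lborel. integrable cell_measure (\<lambda>a. ?g (z, a))"
      by simp
    have "(\<integral>a. norm (?g (z, a)) \<partial>cell_measure) =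
        ((\<integral>a. (u a)\<^sup>2 \<partial>cell_measure) + (\<integral>a. (v a)\<^sup>2 \<partial>cell_measure)) * \<bar>\<psi> z\<bar>" for z
      using L2_D(2)[OF u] L2_D(2)[OF L2_translate(1)[OF v, of z]] L2_translate(2)[OF v, of z]
      by (simp add: abs_mult)
    then show "integrable lborel (\<lambda>z. \<integral>a. norm (?g (z, a)) \<partial>cell_measure)"
      using \<psi> by simp
    show "?g \<in> borel_measurable (lborel \<Otimes>\<^sub>M cell_measure)"
      by (simp add: case_prod_unfold)
  qed
  have "integrable (lborel \<Otimes>\<^sub>M cell_measure) (\<lambda>(z, a). u a * v (a + z) * \<psi> z)"
  proof (rule Bochner_Integration.integrable_bound[OF g])
    show "(\<lambda>(z, a). u a * v (a + z) * \<psi> z) \<in> borel_measurable (lborel \<Otimes>\<^sub>M cell_measure)"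
      by (simp add: case_prod_unfold)
    have "\<bar>a * b\<bar> \<le> a\<^sup>2 + b\<^sup>2" for a b :: real
      using mult_le_sum_squares[of 1 a b] by (auto intro: order_trans)
    then show "AE x in lborel \<Otimes>\<^sub>M cell_measure. norm (case x of (z, a) \<Rightarrow> u a * v (a + z) * \<psi> z) \<le> norm (?g x)"
      by (auto simp: abs_mult intro!: mult_right_mono AE_I2)
  qed
  then show ?thesis
    by (subst cell_lborel.integrable_product_swap_iff[symmetric]) simp
qed

lemma integral_lborel_uminus:
  fixes h :: "real^3 \<Rightarrow> real"
  assumes "h \<in> borel_measurable borel"
  shows "(\<integral>z. h (- z) \<partial>lborel) = (\<integral>z. h z \<partial>lborel)"
proof -
  have "lborel = distr lborel borel (\<lambda>x. - x :: real^3)"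
    using lborel_affine[of "-1" "0::real^3"] by (simp add: density_1)
  then have "(\<integral>z. h z \<partial>lborel) = (\<integral>z. h z \<partial>distr lborel borel (\<lambda>x. - x))"
    by simp
  also have "\<dots> = (\<integral>z. h (- z) \<partial>lborel)"
    using assms by (intro integral_distr) auto
  finally show ?thesis ..
qed

section \<open>Orthogonality of a field and its weak derivative\<close>

text \<open>Turns an average over the centres \<open>a\<close> of translated kernels into one
  integral of the kernel against the correlation.\<close>

lemma corr_Fubini:
  assumes u: "u \<in> borel_measurable borel" "u \<in> L2 cell_measure" and v: "periodic_L2 v"
    and \<psi>: "integrable lborel \<psi>"
  shows "integrable cell_measure (\<lambda>a. \<integral>z. u a * v (a + z) * \<psi> z \<partial>lborel)"
    and "integrable lborel (\<lambda>z. \<psi> z * corr u v z)"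
    and "(\<integral>a. (\<integral>z. u a * v (a + z) * \<psi> z \<partial>lborel) \<partial>cell_measure) = (\<integral>z. \<psi> z * corr u v z \<partial>lborel)"
proof -
  note int = integrable_cell_lborel[OF u v \<psi>]
  have *: "(\<integral>a. u a * v (a + z) * \<psi> z \<partial>cell_measure) = \<psi> z * corr u v z" for z
    by (simp add: corr_def mult.commute)
  show "integrable cell_measure (\<lambda>a. \<integral>z. u a * v (a + z) * \<psi> z \<partial>lborel)"
    using cell_lborel.integrable_fst[OF int] .
  show "integrable lborel (\<lambda>z. \<psi> z * corr u v z)"
    using cell_lborel.integrable_snd[OF int] unfolding * .
  show "(\<integral>a. (\<integral>z. u a * v (a + z) * \<psi> z \<partial>lborel) \<partial>cell_measure) = (\<integral>z. \<psi> z * corr u v z \<partial>lborel)"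
    using cell_lborel.Fubini_integral[OF int] unfolding * by (rule sym)
qed

text \<open>The product integrability with first factor 1, restricted to sections. It permits
  splitting finite sums under the integral for almost every centre.\<close>

lemma AE_cell_integrable_shift:
  assumes "periodic_L2 v" "integrable lborel \<psi>"
  shows "AE a in cell_measure. integrable lborel (\<lambda>z. v (a + z) * \<psi> z)"
proof -
  have "(\<lambda>_. 1) \<in> L2 cell_measure"
    by (rule bounded_in_L2_cell[where B=1]) auto
  from cell_lborel.AE_integrable_fst[OF integrable_cell_lborel[OF _ this assms]] show ?thesis
    by simp
qed

lemma integral_lborel_translate:
  fixes h :: "real^3 \<Rightarrow> real"
  assumes "h \<in> borel_measurable borel"
  shows "(\<integral>z. h (a + z) \<partial>lborel) = (\<integral>y. h y \<partial>lborel)"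
proof -
  have "(\<integral>y. h y \<partial>lborel) = (\<integral>y. h y \<partial>distr lborel borel ((+) a))"
    by (simp add: lborel_distr_plus)
  also have "\<dots> = (\<integral>z. h (a + z) \<partial>lborel)"
    using assms by (intro integral_distr) auto
  finally show ?thesis ..
qed

lemma periodic_L2_D:
  assumes "periodic_L2 v"
  shows "v \<in> borel_measurable borel" "periodic v" "v \<in> L2 cell_measure"
  using assms by (auto simp: periodic_L2_def)

lemma antisymmetric_corr_integral:
  assumes "periodic_L2 u" "periodic_L2 v"
  shows "(\<integral>z. bump_grad r i z * corr u v z \<partial>lborel) = - (\<integral>z. bump_grad r i z * corr v u z \<partial>lborel)"
proof -
  have "integrable lborel (\<lambda>z. bump_grad r i z * corr u v z)"
    by (rule corr_Fubini(2)) (use assms in \<open>auto intro: periodic_L2_D integrable_bump_grad\<close>)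
  then have "(\<integral>z. bump_grad r i z * corr u v z \<partial>lborel) = (\<integral>z. bump_grad r i (- z) * corr u v (- z) \<partial>lborel)"
    by (intro integral_lborel_uminus[symmetric]) auto
  then show ?thesis
    by (simp add: bump_grad_uminus corr_uminus[OF assms])
qed

lemma sum_symmetric_antisymmetric_eq_0:
  fixes A T :: "'a \<Rightarrow> 'a \<Rightarrow> real"
  assumes "\<And>j k. j \<in> J \<Longrightarrow> k \<in> J \<Longrightarrow> A j k = A k j" "\<And>j k. j \<in> J \<Longrightarrow> k \<in> J \<Longrightarrow> T j k = - T k j"
  shows "(\<Sum>j\<in>J. \<Sum>k\<in>J. A j k * T j k) = 0"
proof -
  have "(\<Sum>j\<in>J. \<Sum>k\<in>J. A j k * T j k) = (\<Sum>j\<in>J. \<Sum>k\<in>J. - (A k j * T k j))"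
    using assms by (intro sum.cong refl) (metis mult_minus_right)
  also have "\<dots> = - (\<Sum>k\<in>J. \<Sum>j\<in>J. A k j * T k j)"
    by (subst sum.swap) (simp add: sum_negf)
  finally show ?thesis by simp
qed

text \<open>The weak equation tested with the bump centred at \<open>a\<close> is multiplied by
  \<open>u j a\<close> and integrated over the cell; Fubini turns every term into a correlation
  integral.\<close>

lemma bump_corr_integral_eq_0:
  fixes u g :: "nat \<Rightarrow> real^3 \<Rightarrow> real" and A :: "3 \<Rightarrow> nat \<Rightarrow> nat \<Rightarrow> real"
  assumes J: "finite J"
    and u: "\<And>j. j \<in> J \<Longrightarrow> periodic_L2 (u j)" and g: "\<And>j. j \<in> J \<Longrightarrow> periodic_L2 (g j)"
    and A: "\<And>i j k. A i j k = A i k j"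
    and weak: "\<And>j a. j \<in> J \<Longrightarrow>
      (\<integral>y. (\<Sum>i\<in>UNIV. (\<Sum>k\<in>J. A i j k * u k y) * bump_grad r i (y - a)) \<partial>lborel)
        = - (\<integral>y. g j y * bump r (y - a) \<partial>lborel)"
  shows "(\<integral>z. bump r z * (\<Sum>j\<in>J. corr (u j) (g j) z) \<partial>lborel) = 0"
proof -
  have [measurable]: "u j \<in> borel_measurable borel" "g j \<in> borel_measurable borel" if "j \<in> J" for j
    using u[OF that] g[OF that] by (auto dest: periodic_L2_D)
  have [measurable]: "bump r \<in> borel_measurable borel" "bump_grad r i \<in> borel_measurable borel" for i
    by (intro borel_measurable_continuous_onI continuous_on_bump continuous_on_bump_grad)+
  note uL2 = periodic_L2_D(1,3)[OF u]
  have ae: "AE a in cell_measure. \<forall>i. \<forall>k\<in>J. integrable lborel (\<lambda>z. u k (a + z) * bump_grad r i z)"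
    using J by (auto simp: AE_all_countable AE_finite_all intro!: AE_cell_integrable_shift u integrable_bump_grad)
  have "(\<integral>z. bump r z * corr (u j) (g j) z \<partial>lborel) =
      - (\<Sum>i\<in>UNIV. \<Sum>k\<in>J. A i j k * (\<integral>z. bump_grad r i z * corr (u j) (u k) z \<partial>lborel))"
    if j: "j \<in> J" for j
  proof -
    note int = corr_Fubini(1)[OF uL2[OF j] u integrable_bump_grad]
    have "(\<integral>z. bump r z * corr (u j) (g j) z \<partial>lborel) =
        (\<integral>a. (\<integral>z. u j a * g j (a + z) * bump r z \<partial>lborel) \<partial>cell_measure)"
      using corr_Fubini(3)[OF uL2[OF j] g[OF j] integrable_bump] by simp
    also have "\<dots> = (\<integral>a. - (\<Sum>i\<in>UNIV. \<Sum>k\<in>J. A i j k *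
        (\<integral>z. u j a * u k (a + z) * bump_grad r i z \<partial>lborel)) \<partial>cell_measure)"
    proof (rule integral_cong_AE)
      show "(\<lambda>a. \<integral>z. u j a * g j (a + z) * bump r z \<partial>lborel) \<in> borel_measurable cell_measure"
        using corr_Fubini(1)[OF uL2[OF j] g[OF j] integrable_bump] by simp
      show "(\<lambda>a. - (\<Sum>i\<in>UNIV. \<Sum>k\<in>J. A i j k * (\<integral>z. u j a * u k (a + z) * bump_grad r i z \<partial>lborel)))
          \<in> borel_measurable cell_measure"
        using int[THEN borel_measurable_integrable] by (intro borel_measurable_uminus borel_measurable_sum
          borel_measurable_times borel_measurable_const)
      show "AE a in cell_measure. (\<integral>z. u j a * g j (a + z) * bump r z \<partial>lborel) =
          - (\<Sum>i\<in>UNIV. \<Sum>k\<in>J. A i j k * (\<integral>z. u j a * u k (a + z) * bump_grad r i z \<partial>lborel))"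
        using ae
      proof eventually_elim
        fix a assume a: "\<forall>i. \<forall>k\<in>J. integrable lborel (\<lambda>z. u k (a + z) * bump_grad r i z)"
        have "(\<integral>z. g j (a + z) * bump r z \<partial>lborel) = (\<integral>y. g j y * bump r (y - a) \<partial>lborel)"
          using integral_lborel_translate[of "\<lambda>y. g j y * bump r (y - a)" a] j by simp
        also have "\<dots> = - (\<integral>y. (\<Sum>i\<in>UNIV. (\<Sum>k\<in>J. A i j k * u k y) * bump_grad r i (y - a)) \<partial>lborel)"
          using weak[OF j, of a] by simp
        also have "\<dots> = - (\<integral>z. (\<Sum>i\<in>UNIV. (\<Sum>k\<in>J. A i j k * u k (a + z)) * bump_grad r i z) \<partial>lborel)"
          using integral_lborel_translate[of "\<lambda>y. \<Sum>i\<in>UNIV. (\<Sum>k\<in>J. A i j k * u k y) * bump_grad r i (y - a)" a]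
          by simp
        also have "\<dots> = - (\<integral>z. (\<Sum>i\<in>UNIV. \<Sum>k\<in>J. A i j k * (u k (a + z) * bump_grad r i z)) \<partial>lborel)"
          by (simp add: sum_distrib_right mult.assoc)
        also have "\<dots> = - (\<Sum>i\<in>UNIV. \<Sum>k\<in>J. A i j k * (\<integral>z. u k (a + z) * bump_grad r i z \<partial>lborel))"
          using a by (simp add: Bochner_Integration.integral_sum)
        finally have *: "(\<integral>z. g j (a + z) * bump r z \<partial>lborel) =
            - (\<Sum>i\<in>UNIV. \<Sum>k\<in>J. A i j k * (\<integral>z. u k (a + z) * bump_grad r i z \<partial>lborel))" .
        \<comment> \<open>Valid without integrability: if the integrand on the right is not
          integrable, both sides are 0.\<close>
        have pull: "(\<integral>z. u j a * h z * p z \<partial>lborel) = u j a * (\<integral>z. h z * p z \<partial>lborel)" for h p :: "real^3 \<Rightarrow> real"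
          by (simp add: mult.assoc)
        have "(\<integral>z. u j a * g j (a + z) * bump r z \<partial>lborel) = u j a *
            - (\<Sum>i\<in>UNIV. \<Sum>k\<in>J. A i j k * (\<integral>z. u k (a + z) * bump_grad r i z \<partial>lborel))"
          by (simp only: pull *)
        also have "\<dots> = - (\<Sum>i\<in>UNIV. \<Sum>k\<in>J. A i j k *
            (u j a * (\<integral>z. u k (a + z) * bump_grad r i z \<partial>lborel)))"
          by (simp only: sum_distrib_left mult_minus_right mult.left_commute[of "u j a"])
        finally show "(\<integral>z. u j a * g j (a + z) * bump r z \<partial>lborel) =
            - (\<Sum>i\<in>UNIV. \<Sum>k\<in>J. A i j k * (\<integral>z. u j a * u k (a + z) * bump_grad r i z \<partial>lborel))"
          by (simp only: pull)
      qed
    qed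
    also have "\<dots> = - (\<Sum>i\<in>UNIV. \<Sum>k\<in>J. A i j k *
        (\<integral>a. (\<integral>z. u j a * u k (a + z) * bump_grad r i z \<partial>lborel) \<partial>cell_measure))"
      using int by (simp add: Bochner_Integration.integral_sum)
    also have "\<dots> = - (\<Sum>i\<in>UNIV. \<Sum>k\<in>J. A i j k * (\<integral>z. bump_grad r i z * corr (u j) (u k) z \<partial>lborel))"
      using corr_Fubini(3)[OF uL2[OF j] u integrable_bump_grad] by simp
    finally show ?thesis .
  qed
  then have "(\<Sum>j\<in>J. \<integral>z. bump r z * corr (u j) (g j) z \<partial>lborel) =
      - (\<Sum>j\<in>J. \<Sum>i\<in>UNIV. \<Sum>k\<in>J. A i j k * (\<integral>z. bump_grad r i z * corr (u j) (u k) z \<partial>lborel))"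
    by (simp add: sum_negf)
  \<comment> \<open>With the direction \<open>i\<close> outermost, a symmetric matrix meets an
    antisymmetric array of integrals.\<close>
  also have "\<dots> = - (\<Sum>i\<in>UNIV. \<Sum>j\<in>J. \<Sum>k\<in>J. A i j k * (\<integral>z. bump_grad r i z * corr (u j) (u k) z \<partial>lborel))"
    by (subst sum.swap) simp
  also have "\<dots> = 0"
  proof -
    have "(\<Sum>j\<in>J. \<Sum>k\<in>J. A i j k * (\<integral>z. bump_grad r i z * corr (u j) (u k) z \<partial>lborel)) = 0" for i
      by (rule sum_symmetric_antisymmetric_eq_0) (rule A, rule antisymmetric_corr_integral[OF u u])
    then show ?thesis by simp
  qed
  finally have "(\<Sum>j\<in>J. \<integral>z. bump r z * corr (u j) (g j) z \<partial>lborel) = 0" .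
  then show ?thesis
    using corr_Fubini(2)[OF uL2 g integrable_bump]
    by (simp add: sum_distrib_left Bochner_Integration.integral_sum)
qed

text \<open>Near 0 the function keeps the sign of its value there. A bump supported in that
  neighbourhood gives an integrand of one sign that vanishes nowhere inside the ball, and a ball is
  not a null set.\<close>

lemma integral_bump_nonzero:
  assumes c: "isCont c 0" and "c 0 \<noteq> 0" and int: "\<And>r. integrable lborel (\<lambda>z. bump r z * c z)"
  shows "\<exists>r. (\<integral>z. bump r z * c z \<partial>lborel) \<noteq> 0"
proof -
  define s where "s = sgn (c 0)"
  have "s * c 0 > 0" "s \<noteq> 0"
    using \<open>c 0 \<noteq> 0\<close> by (auto simp: s_def sgn_if)
  moreover have "isCont (\<lambda>z. s * c z) 0"
    using c by (intro continuous_intros)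
  then have "((\<lambda>z. s * c z) \<longlongrightarrow> s * c 0) (nhds 0)"
    using tendsto_at_iff_tendsto_nhds[of "\<lambda>z. s * c z" 0] by (simp add: isCont_def)
  ultimately have "eventually (\<lambda>z. s * c z > 0) (nhds 0)"
    using order_tendstoD(1) by blast
  then obtain r where r: "r > 0" "\<And>z. norm z < r \<Longrightarrow> s * c z > 0"
    by (auto simp: eventually_nhds_metric)
  have nonneg: "s * (bump r z * c z) \<ge> 0" for z
  proof (cases "norm z < r")
    case True
    then have "bump r z * (s * c z) \<ge> 0"
      using r(2)[of z] bump_nonneg[of r z] by simp
    then show ?thesis by (simp add: ac_simps)
  next
    case False
    then show ?thesis using r(1) by (simp add: bump_eq_0)
  qed
  have "(\<integral>z. s * (bump r z * c z) \<partial>lborel) \<noteq> 0"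
  proof
    assume "(\<integral>z. s * (bump r z * c z) \<partial>lborel) = 0"
    then have "AE z in lborel. s * (bump r z * c z) = 0"
      using int[of r] nonneg by (subst (asm) integral_nonneg_eq_0_iff_AE) auto
    then have "AE z in lborel. (z::real^3) \<notin> ball 0 r"
    proof (rule eventually_mono)
      fix z assume "s * (bump r z * c z) = 0"
      then show "z \<notin> ball 0 r"
        using bump_pos[of z r] r(2)[of z] by auto
    qed
    then have "ball 0 r \<in> null_sets (lborel :: (real^3) measure)"
      by (intro iffD2[OF AE_iff_null_sets]) auto
    then have "negligible (ball (0::real^3) r)"
      by (simp add: negligible_iff_null_sets null_sets_completionI)
    then show False
      using open_not_negligible[of "ball (0::real^3) r"] r(1) by simp
  qed
  then show ?thesis by auto
qed

text \<open>The sum in question is the value at 0 of a function continuous there, all of whose bump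
  integrals vanish. Arguing by contradiction needs no normalised bumps and no limit in the
  radius.\<close>

lemma energy_identity:
  fixes u g :: "nat \<Rightarrow> real^3 \<Rightarrow> real" and A :: "3 \<Rightarrow> nat \<Rightarrow> nat \<Rightarrow> real"
  assumes J: "finite J"
    and u: "\<And>j. j \<in> J \<Longrightarrow> periodic_L2 (u j)" and g: "\<And>j. j \<in> J \<Longrightarrow> periodic_L2 (g j)"
    and A: "\<And>i j k. A i j k = A i k j"
    and weak: "\<And>r j a. j \<in> J \<Longrightarrow>
      (\<integral>y. (\<Sum>i\<in>UNIV. (\<Sum>k\<in>J. A i j k * u k y) * bump_grad r i (y - a)) \<partial>lborel)
        = - (\<integral>y. g j y * bump r (y - a) \<partial>lborel)"
  shows "(\<Sum>j\<in>J. \<integral>a. u j a * g j a \<partial>cell_measure) = 0"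
proof (rule ccontr)
  let ?c = "\<lambda>z. \<Sum>j\<in>J. corr (u j) (g j) z"
  assume "(\<Sum>j\<in>J. \<integral>a. u j a * g j a \<partial>cell_measure) \<noteq> 0"
  then have "?c 0 \<noteq> 0"
    by (simp add: corr_def)
  moreover have "isCont ?c 0"
  proof (rule isCont_sum, rule ballI)
    fix j assume "j \<in> J"
    with u g show "isCont (corr (u j) (g j)) 0"
      using isCont_corr periodic_L2_D by blast
  qed
  moreover have "integrable lborel (\<lambda>z. bump r z * ?c z)" for r
    unfolding sum_distrib_left
    by (intro Bochner_Integration.integrable_sum corr_Fubini(2)[OF periodic_L2_D(1,3)[OF u] g integrable_bump])
  ultimately obtain r where "(\<integral>z. bump r z * ?c z \<partial>lborel) \<noteq> 0"
    using integral_bump_nonzero[of ?c] by auto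
  moreover have "(\<integral>z. bump r z * ?c z \<partial>lborel) = 0"
    by (rule bump_corr_integral_eq_0[OF J u g A weak])
  ultimately show False
    by simp
qed

section \<open>Transfer from Lebesgue measurable fields to Borel representatives\<close>

text \<open>Cut off to the cube, take a Borel version and periodise it. Equality is required almost
  everywhere in the whole space, since test functions may reach across many cells.\<close>

lemma borel_representative:
  assumes v: "periodic v" "v \<in> L2 (lebesgue_on cube)"
  shows "\<exists>w. periodic_L2 w \<and> (AE x in lborel. v x = w x)"
proof -
  have cube: "cube \<in> sets lebesgue" "cube \<in> sets borel" "cube \<in> sets lborel"
    using open_cube by auto
  have "(\<lambda>x. if x \<in> cube then v x else 0) \<in> borel_measurable lebesgue"
    using v(2) cube(1) by (simp add: L2_def borel_measurable_if)
  then obtain b where [measurable]: "b \<in> borel_measurable borel"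
    and b: "AE x in lborel. (if x \<in> cube then v x else 0) = b x"
    using completion_ex_borel_measurable_real[of "\<lambda>x. if x \<in> cube then v x else 0" lborel] by auto
  define w where "w x = b (frac_vec x)" for x
  have [measurable]: "w \<in> borel_measurable borel"
    unfolding w_def by measurable
  have w: "periodic w"
    unfolding w_def by (rule periodic_comp_frac_vec)
  from b obtain E where E: "E \<in> null_sets lborel"
      "{x. (if x \<in> cube then v x else 0) \<noteq> b x} \<subseteq> E"
    by (auto simp: eventually_ae_filter)
  \<comment> \<open>The lattice vector taking x into the cell varies with x, so all countably many
    translates of the exceptional set are avoided at once.\<close>
  have "AE x in lborel. \<forall>k\<in>{k. \<forall>i. k $ i \<in> \<int>}. x + k \<notin> E"
  proof (subst AE_ball_countable[OF countable_Ints_vec], safe)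
    fix k :: "real^3"
    have "E \<in> sets borel" using E(1) by auto
    then have "{x. x + k \<in> E} \<in> sets borel" 
      by (auto intro: borel_measurable_add measurable_sets_borel[of "\<lambda>x. x + k", unfolded vimage_def])
    moreover have "emeasure lborel {x. x + k \<in> E} = 0"
    proof -
      have "emeasure lborel {x. x + k \<in> E} = (\<integral>\<^sup>+x. indicator E (x + k) \<partial>lborel)"
        using calculation by (simp flip: nn_integral_indicator add: indicator_def)
      also have "\<dots> = (\<integral>\<^sup>+x. indicator E x \<partial>lborel)"
        using \<open>E \<in> sets borel\<close> by (intro nn_integral_lborel_translate) auto
      also have "\<dots> = 0"
        using E(1) by (subst nn_integral_indicator) auto
      finally show ?thesis .
    qed
    ultimately show "AE x in lborel. x + k \<notin> E"
      by (intro AE_I'[of "{x. x + k \<in> E}"]) auto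
  qed
  with AE_lborel_not_Ints have ae: "AE x in lborel. v x = w x"
  proof eventually_elim
    fix x :: "real^3"
    assume x: "\<forall>i. x $ i \<notin> \<int>" "\<forall>k\<in>{k. \<forall>i. k $ i \<in> \<int>}. x + k \<notin> E"
    have "frac_vec x - x \<in> {k. \<forall>i. k $ i \<in> \<int>}"
      by (simp add: frac_vec_def frac_def)
    then have "x + (frac_vec x - x) \<notin> E" using x(2) by blast
    then have "frac_vec x \<notin> E" by simp
    moreover have "frac_vec x \<in> cube"
      using x(1) by (simp add: cube_def frac_vec_def frac_lt_1)
    ultimately have "v (frac_vec x) = b (frac_vec x)"
      using E(2) by (metis (mono_tags, lifting) mem_Collect_eq subsetD)
    then show "v x = w x"
      by (simp add: w_def periodic_frac_vec[OF v(1)])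
  qed
  have "integrable (lebesgue_on cube) (\<lambda>x. (v x)\<^sup>2)"
    using v(2) by (rule L2_D)
  then have 1: "integrable lebesgue (\<lambda>x. indicator cube x *\<^sub>R (v x)\<^sup>2)"
    using cube by (simp add: integrable_restrict_space)
  have ae2: "AE x in lborel. indicator cube x *\<^sub>R (v x)\<^sup>2 = indicator cell x *\<^sub>R (w x)\<^sup>2"
    using ae AE_lborel_not_Ints
    by eventually_elim (use cell_not_Ints cube_subset_cell in \<open>auto simp: indicator_def\<close>)
  have "integrable lebesgue (\<lambda>x. indicator cell x *\<^sub>R (w x)\<^sup>2)"
    by (rule integrable_cong_AE_imp[OF 1]) (use ae2 in \<open>auto simp: AE_completion_iff intro!: measurable_completion\<close>)
  then have "integrable lborel (\<lambda>x. indicator cell x *\<^sub>R (w x)\<^sup>2)"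
    by (subst (asm) integrable_completion) auto
  then have "w \<in> L2 cell_measure"
    by (simp add: L2_def integrable_restrict_space)
  with w have "periodic_L2 w"
    by (simp add: periodic_L2_def)
  with ae show ?thesis
    by blast
qed

text \<open>Measurability of \<open>f\<close> comes from that of \<open>h\<close> by completeness of
  Lebesgue measure.\<close>

lemma integral_lebesgue_cong_borel:
  fixes f :: "real^3 \<Rightarrow> real"
  assumes "h \<in> borel_measurable borel" "AE x in lborel. f x = h x"
  shows "integral\<^sup>L lebesgue f = integral\<^sup>L lborel h"
proof -
  have ae: "AE x in lebesgue. h x = f x"
    using assms(2) by (auto simp: AE_completion_iff elim: eventually_mono)
  have h: "h \<in> borel_measurable lebesgue"
    using assms(1) by (simp add: measurable_completion)
  have "integral\<^sup>L lebesgue f = integral\<^sup>L lebesgue h"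
    by (rule integral_cong_AE) (use borel_measurable_AE[OF h ae] h ae in \<open>auto elim: eventually_mono\<close>)
  also have "\<dots> = integral\<^sup>L lborel h"
    using assms(1) by (intro integral_completion) simp
  finally show ?thesis .
qed

lemma integral_cube_eq_cell:
  fixes f :: "real^3 \<Rightarrow> real"
  assumes [measurable]: "h \<in> borel_measurable borel" and "AE x in lborel. f x = h x"
  shows "(\<integral>x. f x \<partial>lebesgue_on cube) = (\<integral>x. h x \<partial>cell_measure)"
proof -
  have "(\<integral>x. f x \<partial>lebesgue_on cube) = (\<integral>x. indicator cube x *\<^sub>R f x \<partial>lebesgue)"
    using open_cube by (intro integral_restrict_space) auto
  also have "\<dots> = (\<integral>x. indicator cell x *\<^sub>R h x \<partial>lborel)"
  proof (rule integral_lebesgue_cong_borel)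
    show "AE x in lborel. indicator cube x *\<^sub>R f x = indicator cell x *\<^sub>R h x"
      using assms(2) AE_lborel_not_Ints
      by eventually_elim (use cell_not_Ints cube_subset_cell in \<open>auto simp: indicator_def\<close>)
  qed measurable
  also have "\<dots> = (\<integral>x. h x \<partial>cell_measure)"
    by (intro integral_restrict_space[symmetric]) auto
  finally show ?thesis .
qed

text \<open>Passing to Borel periodic representatives changes neither the tested equations nor the
  pairings, so \<open>energy_identity\<close> applies; the matrices are symmetric by commutativity
  in their integrands.\<close>

lemma weak_A_derivative_orthogonal:
  assumes u: "periodic_L2_vec N u" and g: "periodic_L2_vec N g" and weak: "has_weak_A_derivative N u g"
  shows "(\<Sum>j=1..dimPN N. \<integral>x. u x j * g x j \<partial>lebesgue_on cube) = 0"
proof -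
  define J where "J = {1..dimPN N}"
  have "\<forall>j\<in>J. \<exists>w. periodic_L2 w \<and> (AE x in lborel. u x j = w x)"
    using u borel_representative by (auto simp: periodic_L2_vec_def J_def)
  then obtain u' where u': "\<And>j. j \<in> J \<Longrightarrow> periodic_L2 (u' j)" "\<And>j. j \<in> J \<Longrightarrow> AE x in lborel. u x j = u' j x"
    by metis
  have "\<forall>j\<in>J. \<exists>w. periodic_L2 w \<and> (AE x in lborel. g x j = w x)"
    using g borel_representative by (auto simp: periodic_L2_vec_def J_def)
  then obtain g' where g': "\<And>j. j \<in> J \<Longrightarrow> periodic_L2 (g' j)" "\<And>j. j \<in> J \<Longrightarrow> AE x in lborel. g x j = g' j x"
    by metis
  have [measurable]: "u' j \<in> borel_measurable borel" "g' j \<in> borel_measurable borel" if "j \<in> J" for j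
    using u'(1)[OF that] g'(1)[OF that] by (auto dest: periodic_L2_D)
  have [measurable]: "bump r \<in> borel_measurable borel" "bump_grad r i \<in> borel_measurable borel" for r i
    by (intro borel_measurable_continuous_onI continuous_on_bump continuous_on_bump_grad)+
  have aeu: "AE x in lborel. \<forall>j\<in>J. u x j = u' j x"
    using u'(2) by (subst AE_finite_all) (auto simp: J_def)
  have "(\<Sum>j\<in>J. \<integral>a. u' j a * g' j a \<partial>cell_measure) = 0"
  proof (rule energy_identity[OF _ u'(1) g'(1)])
    show "Amat N i j k = Amat N i k j" for i j k
      by (simp add: Amat_def ac_simps)
    fix r j and a :: "real^3" assume j: "j \<in> J"
    let ?l = "\<lambda>y. \<Sum>i\<in>UNIV. (\<Sum>k\<in>J. Amat N i j k * u' k y) * bump_grad r i (y - a)"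
    have "(\<integral>y. ?l y \<partial>lborel) =
        (\<integral>x. (\<Sum>i\<in>UNIV. (\<Sum>k\<in>J. Amat N i j k * u x k) * bump_grad r i (x - a)) \<partial>lebesgue)"
    proof (rule integral_lebesgue_cong_borel[symmetric])
      show "AE x in lborel. (\<Sum>i\<in>UNIV. (\<Sum>k\<in>J. Amat N i j k * u x k) * bump_grad r i (x - a)) = ?l x"
        using aeu by eventually_elim simp
    qed measurable
    also have "\<dots> = - (\<integral>x. g x j * bump r (x - a) \<partial>lebesgue)"
      using weak[unfolded has_weak_A_derivative_def, rule_format, OF _ bump_test_function, of j r a] j
      by (simp add: J_def partial_deriv_bump)
    also have "(\<integral>x. g x j * bump r (x - a) \<partial>lebesgue) = (\<integral>y. g' j y * bump r (y - a) \<partial>lborel)"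
      using g'(2)[OF j] j by (intro integral_lebesgue_cong_borel) (auto elim: eventually_mono)
    finally show "(\<integral>y. ?l y \<partial>lborel) = - (\<integral>y. g' j y * bump r (y - a) \<partial>lborel)" .
  qed (simp add: J_def)
  also have "(\<Sum>j\<in>J. \<integral>a. u' j a * g' j a \<partial>cell_measure) = (\<Sum>j\<in>J. \<integral>x. u x j * g x j \<partial>lebesgue_on cube)"
  proof (intro sum.cong refl integral_cube_eq_cell[symmetric])
    fix j assume j: "j \<in> J"
    show "AE x in lborel. u x j * g x j = u' j x * g' j x"
      using u'(2)[OF j] g'(2)[OF j] by eventually_elim simp
  qed measurable
  finally show ?thesis
    by (simp add: J_def)
qed

section \<open>The energy estimate\<close>

lemma L2_cmult: "f \<in> L2 M \<Longrightarrow> (\<lambda>x. c * f x) \<in> L2 M"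
  by (auto simp: L2_def power_mult_distrib)

lemma L2_add: "f \<in> L2 M \<Longrightarrow> g \<in> L2 M \<Longrightarrow> (\<lambda>x. f x + g x) \<in> L2 M"
  using L2_diff[of f M "\<lambda>x. - 1 * g x"] L2_cmult[of g M "- 1"] by simp

lemma Linfty_mult_L2:
  assumes "\<sigma> \<in> Linfty M" "f \<in> L2 M"
  shows "(\<lambda>x. \<sigma> x * f x) \<in> L2 M"
proof -
  from assms obtain K where [measurable]: "\<sigma> \<in> borel_measurable M" "f \<in> borel_measurable M"
    and K: "AE x in M. \<bar>\<sigma> x\<bar> \<le> K" and f: "integrable M (\<lambda>x. (f x)\<^sup>2)"
    by (auto simp: Linfty_def L2_def)
  have "integrable M (\<lambda>x. (\<sigma> x * f x)\<^sup>2)"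
  proof (rule Bochner_Integration.integrable_bound)
    show "integrable M (\<lambda>x. K\<^sup>2 * (f x)\<^sup>2)"
      using f by simp
    show "AE x in M. norm ((\<sigma> x * f x)\<^sup>2) \<le> norm (K\<^sup>2 * (f x)\<^sup>2)"
      using K
    proof eventually_elim
      fix x assume "\<bar>\<sigma> x\<bar> \<le> K"
      then have "(\<sigma> x)\<^sup>2 \<le> K\<^sup>2"
        by (metis abs_ge_zero power2_abs power_mono)
      then show "norm ((\<sigma> x * f x)\<^sup>2) \<le> norm (K\<^sup>2 * (f x)\<^sup>2)"
        by (simp add: power_mult_distrib mult_right_mono)
    qed
  qed measurable
  then show ?thesis
    by (simp add: L2_def)
qed

text \<open>Extension by zero reduces measurability of \<open>f\<close> to completeness of Lebesgue
  measure on the whole space.\<close>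

lemma L2_cong_AE_cube:
  assumes h: "h \<in> L2 (lebesgue_on cube)" and ae: "AE x in lebesgue_on cube. h x = f x"
  shows "f \<in> L2 (lebesgue_on cube)"
proof -
  have cube: "cube \<in> sets lebesgue"
    using open_cube by auto
  have "(\<lambda>x. if x \<in> cube then h x else 0) \<in> borel_measurable lebesgue"
    using L2_D(1)[OF h] cube by (simp add: borel_measurable_if)
  moreover have "AE x in lebesgue. (if x \<in> cube then h x else 0) = (if x \<in> cube then f x else 0)"
    using ae cube by (subst (asm) AE_restrict_space_iff) (auto elim: eventually_mono)
  ultimately have "(\<lambda>x. if x \<in> cube then f x else 0) \<in> borel_measurable lebesgue"
    by (rule borel_measurable_AE)
  then have f: "f \<in> borel_measurable (lebesgue_on cube)"
    using cube by (simp add: borel_measurable_if)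
  have "integrable (lebesgue_on cube) (\<lambda>x. (f x)\<^sup>2)"
    by (rule integrable_cong_AE_imp[OF L2_D(2)[OF h]]) (use f ae in \<open>auto elim: eventually_mono\<close>)
  with f show ?thesis
    by (simp add: L2_def)
qed

lemma L2_norm_power2: "(L2_norm M f)\<^sup>2 = (\<integral>x. (f x)\<^sup>2 \<partial>M)"
  by (simp add: L2_norm_def)

text \<open>Young's inequality with weight s d/2 costs half of the damping e s d u^2 and leaves the
  other half. The source term is F^2/(2 s d), where d \<ge> 1 allows d to be dropped.\<close>

lemma absorption_inequality:
  fixes e s q u F :: real
  assumes "0 < d" "0 < s" "0 < e" "e * s * d \<le> q" "d \<ge> 1"
  shows "u * (e * F - q * u) \<le> e / (2 * s) * F\<^sup>2 - e * s / 2 * (d * u\<^sup>2)"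
proof -
  have "u * F \<le> s * d / 2 * u\<^sup>2 + F\<^sup>2 / (4 * (s * d / 2))"
    using mult_le_sum_squares[of "s * d / 2" u F] assms by simp
  also have "F\<^sup>2 / (4 * (s * d / 2)) \<le> F\<^sup>2 / (2 * s)"
    using assms by (intro divide_left_mono) (auto simp: mult_pos_pos)
  finally have "e * (u * F) \<le> e * (s * d / 2 * u\<^sup>2 + F\<^sup>2 / (2 * s))"
    using assms by (intro mult_left_mono) auto
  moreover have "e * s * d * u\<^sup>2 \<le> q * u\<^sup>2"
    using assms by (intro mult_right_mono) auto
  ultimately show ?thesis
    by (simp add: power2_eq_square algebra_simps)
qed

text \<open>The diagonal entries satisfy \<epsilon> \<sigma>a \<ge> \<epsilon> s and
  \<sigma>t/\<epsilon> \<ge> \<epsilon> s (1/\<epsilon>^2). With weights 1 and 1/\<epsilon>^2 all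
  damping has the common factor \<epsilon> s, whose \<epsilon> cancels against the one in the
  source.\<close>

lemma PN_energy_estimate:
  assumes \<sigma>: "\<sigma>t \<in> Linfty (lebesgue_on cube)" "\<sigma>a \<in> Linfty (lebesgue_on cube)" and s: "s > 0"
    and lower: "AE x in lebesgue_on cube. \<sigma>t x > \<sigma>a x \<and> \<sigma>a x \<ge> s"
    and \<epsilon>: "0 < \<epsilon>" "\<epsilon> < 1" and sol: "PN_solution N \<epsilon> \<sigma>t \<sigma>a f u"
  shows "(\<Sum>j=1..dimPN N. (if j = 1 then 1 else 1 / \<epsilon>\<^sup>2) * (L2_norm (lebesgue_on cube) (\<lambda>x. u x j))\<^sup>2)
    \<le> (\<Sum>j=1..dimPN N. (L2_norm (lebesgue_on cube) (fvec N f j))\<^sup>2) / s\<^sup>2"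
proof -
  let ?M = "lebesgue_on cube" and ?J = "{1..dimPN N}"
  define d :: "nat \<Rightarrow> real" where "d j = (if j = 1 then 1 else 1 / \<epsilon>\<^sup>2)" for j
  define q where "q j x = (if j = 1 then \<epsilon> * \<sigma>a x else \<sigma>t x / \<epsilon>)" for j :: nat and x
  from sol obtain g where u: "periodic_L2_vec N u" and g: "periodic_L2_vec N g"
    and weak: "has_weak_A_derivative N u g"
    and "AE x in ?M. \<forall>j\<in>?J. g x j + (\<Sum>k=1..dimPN N. Qmat \<epsilon> \<sigma>t \<sigma>a x j k * u x k) = \<epsilon> * fvec N f j x"
    by (auto simp: PN_solution_def)
  moreover have "(\<Sum>k=1..dimPN N. Qmat \<epsilon> \<sigma>t \<sigma>a x j k * u x k) = q j x * u x j" if "j \<in> ?J" for j x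
  proof -
    have "(\<Sum>k=1..dimPN N. Qmat \<epsilon> \<sigma>t \<sigma>a x j k * u x k) = (\<Sum>k=1..dimPN N. if k = j then q j x * u x j else 0)"
      by (intro sum.cong) (auto simp: Qmat_def q_def)
    then show ?thesis using that by simp
  qed
  ultimately have eq: "AE x in ?M. \<forall>j\<in>?J. g x j + q j x * u x j = \<epsilon> * fvec N f j x"
    by (auto elim: eventually_mono)
  have uL2: "(\<lambda>x. u x j) \<in> L2 ?M" and gL2: "(\<lambda>x. g x j) \<in> L2 ?M" if "j \<in> ?J" for j
    using u g that by (auto simp: periodic_L2_vec_def)
  \<comment> \<open>The moments of \<open>f\<close> are read off the equation, so no bound on the harmonics is needed.\<close>
  have fL2: "fvec N f j \<in> L2 ?M" if j: "j \<in> ?J" for j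
  proof (rule L2_cong_AE_cube)
    have "(\<lambda>x. q j x * u x j) \<in> L2 ?M"
    proof (cases "j = 1")
      case True
      then show ?thesis
        using L2_cmult[OF Linfty_mult_L2[OF \<sigma>(2) uL2[OF j]], of \<epsilon>] by (simp add: q_def mult.assoc)
    next
      case False
      then show ?thesis
        using L2_cmult[OF Linfty_mult_L2[OF \<sigma>(1) uL2[OF j]], of "1 / \<epsilon>"] by (simp add: q_def)
    qed
    then show "(\<lambda>x. 1 / \<epsilon> * (g x j + q j x * u x j)) \<in> L2 ?M"
      by (intro L2_cmult L2_add gL2 j)
    show "AE x in ?M. 1 / \<epsilon> * (g x j + q j x * u x j) = fvec N f j x"
      using eq by (rule eventually_mono) (use j \<epsilon> in auto)
  qed
  have bound: "(\<integral>x. u x j * g x j \<partial>?M) \<le>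
      \<epsilon> / (2 * s) * (L2_norm ?M (fvec N f j))\<^sup>2 - \<epsilon> * s / 2 * (d j * (L2_norm ?M (\<lambda>x. u x j))\<^sup>2)" if j: "j \<in> ?J" for j
  proof -
    note int = L2_D(2)[OF uL2[OF j]] L2_D(2)[OF fL2[OF j]]
    have "(\<integral>x. u x j * g x j \<partial>?M) \<le>
        (\<integral>x. \<epsilon> / (2 * s) * (fvec N f j x)\<^sup>2 - \<epsilon> * s / 2 * (d j * (u x j)\<^sup>2) \<partial>?M)"
    proof (rule integral_mono_AE)
      show "AE x in ?M. u x j * g x j \<le> \<epsilon> / (2 * s) * (fvec N f j x)\<^sup>2 - \<epsilon> * s / 2 * (d j * (u x j)\<^sup>2)"
        using eq lower
      proof eventually_elim
        fix x
        assume "\<forall>j\<in>?J. g x j + q j x * u x j = \<epsilon> * fvec N f j x" and \<sigma>: "\<sigma>t x > \<sigma>a x \<and> \<sigma>a x \<ge> s"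
        then have "g x j = \<epsilon> * fvec N f j x - q j x * u x j"
          using j by (metis add_diff_cancel_right')
        moreover have "\<epsilon> * s * d j \<le> q j x"
          using \<sigma> \<epsilon> s by (auto simp: d_def q_def power2_eq_square divide_right_mono)
        moreover have "d j \<ge> 1"
          using \<epsilon> by (auto simp: d_def power_le_one)
        ultimately show "u x j * g x j \<le> \<epsilon> / (2 * s) * (fvec N f j x)\<^sup>2 - \<epsilon> * s / 2 * (d j * (u x j)\<^sup>2)"
          using absorption_inequality[of "d j" s \<epsilon> "q j x" "u x j" "fvec N f j x"] \<epsilon> s by simp
      qed
      show "integrable ?M (\<lambda>x. u x j * g x j)"
        by (rule integrable_mult_L2[OF uL2[OF j] gL2[OF j]])
    qed (use int in simp)
    also have "\<dots> = \<epsilon> / (2 * s) * (L2_norm ?M (fvec N f j))\<^sup>2 - \<epsilon> * s / 2 * (d j * (L2_norm ?M (\<lambda>x. u x j))\<^sup>2)"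
      using int by (simp add: L2_norm_power2)
    finally show ?thesis .
  qed
  have "0 = (\<Sum>j\<in>?J. \<integral>x. u x j * g x j \<partial>?M)"
    using weak_A_derivative_orthogonal[OF u g weak] by simp
  also have "\<dots> \<le> (\<Sum>j\<in>?J. \<epsilon> / (2 * s) * (L2_norm ?M (fvec N f j))\<^sup>2 - \<epsilon> * s / 2 * (d j * (L2_norm ?M (\<lambda>x. u x j))\<^sup>2))"
    by (rule sum_mono) (rule bound)
  also have "\<dots> = \<epsilon> / (2 * s) * (\<Sum>j\<in>?J. (L2_norm ?M (fvec N f j))\<^sup>2) -
      \<epsilon> * s / 2 * (\<Sum>j\<in>?J. d j * (L2_norm ?M (\<lambda>x. u x j))\<^sup>2)"
    by (simp only: sum_subtractf sum_distrib_left)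
  \<comment> \<open>Multiply by 2/(\<epsilon> s).\<close>
  finally have "(\<Sum>j\<in>?J. d j * (L2_norm ?M (\<lambda>x. u x j))\<^sup>2) \<le> (\<Sum>j\<in>?J. (L2_norm ?M (fvec N f j))\<^sup>2) / s\<^sup>2"
    using \<epsilon>(1) s by (simp add: field_simps power2_eq_square)
  then show ?thesis
    by (simp only: d_def)
qed

theorem lemma2p4:
  fixes N :: nat
    and \<sigma>t \<sigma>a :: "real^3 \<Rightarrow> real"
    and \<sigma>min :: real
    and f :: "real^3 \<Rightarrow> real^3 \<Rightarrow> real"
  assumes "\<sigma>t \<in> Linfty (lebesgue_on cube)"
    and "\<sigma>a \<in> Linfty (lebesgue_on cube)"
    and "\<sigma>min > 0"
    and "AE x in lebesgue_on cube. \<sigma>t x > \<sigma>a x \<and> \<sigma>a x \<ge> \<sigma>min"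
    and "(\<lambda>(x, \<omega>). f x \<omega>) \<in> L2 (lebesgue_on cube \<Otimes>\<^sub>M sphere_measure)"
  shows "\<exists>C>0. \<forall>\<epsilon> u.
    0 < \<epsilon> \<and> \<epsilon> < 1 \<and> (AE x in lebesgue_on cube. \<sigma>t x - \<epsilon>\<^sup>2 * \<sigma>a x > 0) \<and>
    PN_solution N \<epsilon> \<sigma>t \<sigma>a f u \<longrightarrow>
      L2_norm (lebesgue_on cube) (\<lambda>x. u x 1) \<le> C \<and>
      (\<forall>i\<in>{2..dimPN N}. L2_norm (lebesgue_on cube) (\<lambda>x. u x i) \<le> C * \<epsilon>) \<and>
      vec_norm N u \<le> C * (1 + \<epsilon>)"
proof -
  let ?M = "lebesgue_on cube" and ?J = "{1..dimPN N}"
  \<comment> \<open>The first summand is the square root of the energy bound and contains no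
    \<epsilon>; adding 1 keeps \<open>C\<close> positive when all moments of \<open>f\<close>
    vanish.\<close>
  define C where "C = sqrt (\<Sum>j\<in>?J. (L2_norm ?M (fvec N f j))\<^sup>2) / \<sigma>min + 1"
  have C1: "C \<ge> 1"
    using assms(3) by (simp add: C_def sum_nonneg)
  have "(\<Sum>j\<in>?J. (L2_norm ?M (fvec N f j))\<^sup>2) / \<sigma>min\<^sup>2 = (C - 1)\<^sup>2"
    by (simp add: C_def power_divide sum_nonneg)
  also have "\<dots> \<le> C\<^sup>2"
    using C1 by (intro power_mono) auto
  finally have C: "(\<Sum>j\<in>?J. (L2_norm ?M (fvec N f j))\<^sup>2) / \<sigma>min\<^sup>2 \<le> C\<^sup>2" .
  have "L2_norm ?M (\<lambda>x. u x 1) \<le> C \<and> (\<forall>i\<in>{2..dimPN N}. L2_norm ?M (\<lambda>x. u x i) \<le> C * \<epsilon>) \<and>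
      vec_norm N u \<le> C * (1 + \<epsilon>)"
    if \<epsilon>: "0 < \<epsilon>" "\<epsilon> < 1" and sol: "PN_solution N \<epsilon> \<sigma>t \<sigma>a f u" for \<epsilon> u
  proof -
    define a where "a j = (if j = 1 then 1 else 1 / \<epsilon>\<^sup>2) * (L2_norm ?M (\<lambda>x. u x j))\<^sup>2" for j
    have a: "(\<Sum>j\<in>?J. a j) \<le> C\<^sup>2"
      using PN_energy_estimate[OF assms(1-4) \<epsilon> sol] C unfolding a_def by (rule order_trans)
    \<comment> \<open>All terms are nonnegative, so the weighted bound holds for each component; the
      weight 1/\<epsilon>^2 becomes the factor \<epsilon> after taking roots.\<close>
    have "a j \<le> (\<Sum>j\<in>?J. a j)" if "j \<in> ?J" for j
      by (rule member_le_sum) (use that in \<open>auto simp: a_def\<close>)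
    with a have aj: "a j \<le> C\<^sup>2" if "j \<in> ?J" for j
      using that by (meson order_trans)
    have "1 \<in> ?J"
      by (simp add: dimPN_def)
    from aj[OF this] have "(L2_norm ?M (\<lambda>x. u x 1))\<^sup>2 \<le> C\<^sup>2"
      by (simp add: a_def)
    then have 1: "L2_norm ?M (\<lambda>x. u x 1) \<le> C"
      by (rule power2_le_imp_le) (use C1 in simp)
    have 2: "L2_norm ?M (\<lambda>x. u x i) \<le> C * \<epsilon>" if "i \<in> {2..dimPN N}" for i
    proof (rule power2_le_imp_le)
      show "(L2_norm ?M (\<lambda>x. u x i))\<^sup>2 \<le> (C * \<epsilon>)\<^sup>2"
        using aj[of i] that \<epsilon> by (simp add: a_def power_mult_distrib pos_divide_le_eq)
    qed (use C1 \<epsilon> in simp)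
    \<comment> \<open>Every weight is at least 1, so the unweighted sum of squares inherits the
      bound.\<close>
    have d: "1 \<le> 1 / \<epsilon>\<^sup>2"
      using \<epsilon> by (simp add: power_le_one)
    have "(L2_norm ?M (\<lambda>x. u x j))\<^sup>2 \<le> a j" for j
      using d mult_right_mono[OF d, of "(L2_norm ?M (\<lambda>x. u x j))\<^sup>2"] by (simp add: a_def)
    then have "(\<Sum>j\<in>?J. (L2_norm ?M (\<lambda>x. u x j))\<^sup>2) \<le> C\<^sup>2"
      by (intro order_trans[OF sum_mono a])
    then have "vec_norm N u \<le> C"
      using C1 by (simp add: vec_norm_def real_le_lsqrt)
    also have "C \<le> C * (1 + \<epsilon>)"
      using C1 \<epsilon> by simp
    finally show ?thesis
      using 1 2 by blast
  qed
  then show ?thesis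
    using C1 by (intro exI[of _ C]) auto
qed

end
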